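(* Let $a,b\in\mathbb{C}$ with $0\le \mathrm{Re}(a)<1$, and let $\mathfrak g=\mathcal{HV}(a,b;1)$. Let $\Omega_{\mathfrak g}(\lambda,\alpha,\beta,\gamma)$, for $\lambda\in\mathbb{C}^*$ and $\alpha,\beta,\gamma\in\mathbb{C}$, be the $\mathfrak g$-modules defined in the context. Say that the parameter $\gamma$ exists if $b=0$, or if $b=1$ and $a\neq 0$ (in all other cases the module does not depend on $\gamma$, and every mention of $\gamma$ below is to be dropped). Then: (1) $\Omega_{\mathfrak g}(\lambda,\alpha,\beta,\gamma)$ is simple if and only if $\alpha\neq0$ or $\gamma\neq0$ (the latter alternative only if $\gamma$ exists). (2) $\Omega_{\mathfrak g}(\lambda,0,\beta,0)$ has a unique nonzero proper submodule, namely $t\,\Omega_{\mathfrak g}(\lambda,0,\beta,0)$, which is isomorphic to $\Omega_{\mathfrak g}(\lambda,1,\beta,0)$, and the quotient $\Omega_{\mathfrak g}(\lambda,0,\beta,0)/t\,\Omega_{\mathfrak g}(\lambda,0,\beta,0)$ is a one-dimensional trivial $\mathfrak g$-module. (3) $\Omega_{\mathfrak g}(\lambda_1,\alpha_1,\beta_1,\gamma_1)\cong\Omega_{\mathfrak g}(\lambda_2,\alpha_2,\beta_2,\gamma_2)$ if and only if they have the same parameters, i.e. $\lambda_1=\lambda_2$, $\alpha_1=\alpha_2$, $\beta_1=\beta_2$ and (if $\gamma$ exists) $\gamma_1=\gamma_2$.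
   Context: $\mathbb{Z}_+$ is the set of nonnegative integers and $\mathbb{C}^*=\mathbb{C}\setminus\{0\}$. $\mathcal{HV}(a,b;1)$ is the complex Lie algebra with basis $\{L_{i,m},H_{j,n}\mid i,j\in\mathbb{Z},\,m,n\in\mathbb{Z}_+\}$ and brackets $[L_{i,m},L_{j,n}]=(j-i)L_{i+j,m+n}-(n-m)L_{i+j,m+n-1}$, $[L_{i,m},H_{j,n}]=(a+j+bi)H_{i+j,m+n}-(n+bm)H_{i+j,m+n-1}$, $[H_{i,m},H_{j,n}]=0$ (when $m=n=0$ the terms with second index $-1$ have coefficient $0$ and are omitted). The module $\Omega_{\mathfrak g}(\lambda,\alpha,\beta,\gamma)$ is the space $\mathbb{C}[t]$ with actions $$L_{i,m}\cdot f(t)=\sum_{s=0}^{m}\binom{m}{s}\lambda^i\left(\beta^{m-s}(t-i\alpha)+(m-s)\alpha\beta^{m-s-1}\right)f^{(s)}(t-i),$$ $$H_{i,m}\cdot f(t)=\begin{cases}\displaystyle\sum_{s=0}^{m}\binom{m}{s}\lambda^i\beta^{m-s}\gamma f^{(s)}(t-a-i), & b=0,\\ \displaystyle\sum_{s=0}^{m}\sum_{\ell=0}^{m-s}\frac{(m-s)!}{(m-s-\ell)!}\binom{m}{s}\frac{a\lambda^i\beta^{m-s-\ell}\gamma}{(a+i)^{\ell+1}}f^{(s)}(t-a-i), & b=1,\ a\neq0,\\ 0, & \text{otherwise},\end{cases}$$ for $i\in\mathbb{Z}$, $m\in\mathbb{Z}_+$, $f(t)\in\mathbb{C}[t]$,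 where $f^{(s)}$ is the $s$-th derivative of $f$. Conventions: $0^0=1$, and $(m-s)\alpha\beta^{m-s-1}$ is $0$ when $s=m$. $t\,\Omega_{\mathfrak g}$ denotes the subspace $t\,\mathbb{C}[t]$. *)

theory Defs
  imports
    "HOL-Algebra.Algebraic_Closure_Type"
    "HOL-Computational_Algebra.Polynomial"
    "HOL-Library.Poly_Mapping"
    Complex_Main
begin

section \<open>Lie algebras and their modules\<close>

text \<open>
  The bracket of a Lie algebra is the \<open>mult\<close> field of the underlying record. As always for
  HOL-Algebra modules, the remaining ring fields (\<open>one\<close>, and \<open>mult\<close> for modules) carry no meaning.
\<close>

locale lie_algebra = module R L for R (structure) and L (structure) +
  assumes bracket_closed:
      "\<lbrakk>x \<in> carrier L; y \<in> carrier L\<rbrakk> \<Longrightarrow> x \<otimes>\<^bsub>L\<^esub> y \<in> carrier L"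
    and bracket_add_left:
      "\<lbrakk>x \<in> carrier L; y \<in> carrier L; z \<in> carrier L\<rbrakk>
        \<Longrightarrow> (x \<oplus>\<^bsub>L\<^esub> y) \<otimes>\<^bsub>L\<^esub> z = (x \<otimes>\<^bsub>L\<^esub> z) \<oplus>\<^bsub>L\<^esub> (y \<otimes>\<^bsub>L\<^esub> z)"
    and bracket_add_right:
      "\<lbrakk>x \<in> carrier L; y \<in> carrier L; z \<in> carrier L\<rbrakk>
        \<Longrightarrow> x \<otimes>\<^bsub>L\<^esub> (y \<oplus>\<^bsub>L\<^esub> z) = (x \<otimes>\<^bsub>L\<^esub> y) \<oplus>\<^bsub>L\<^esub> (x \<otimes>\<^bsub>L\<^esub> z)"
    and bracket_smult_left:
      "\<lbrakk>c \<in> carrier R; x \<in> carrier L; y \<in> carrier L\<rbrakk>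
        \<Longrightarrow> (c \<odot>\<^bsub>L\<^esub> x) \<otimes>\<^bsub>L\<^esub> y = c \<odot>\<^bsub>L\<^esub> (x \<otimes>\<^bsub>L\<^esub> y)"
    and bracket_smult_right:
      "\<lbrakk>c \<in> carrier R; x \<in> carrier L; y \<in> carrier L\<rbrakk>
        \<Longrightarrow> x \<otimes>\<^bsub>L\<^esub> (c \<odot>\<^bsub>L\<^esub> y) = c \<odot>\<^bsub>L\<^esub> (x \<otimes>\<^bsub>L\<^esub> y)"
    and bracket_self: "x \<in> carrier L \<Longrightarrow> x \<otimes>\<^bsub>L\<^esub> x = \<zero>\<^bsub>L\<^esub>"
    and jacobi:
      "\<lbrakk>x \<in> carrier L; y \<in> carrier L; z \<in> carrier L\<rbrakk>
        \<Longrightarrow> (x \<otimes>\<^bsub>L\<^esub> (y \<otimes>\<^bsub>L\<^esub> z)) \<oplus>\<^bsub>L\<^esub> (y \<otimes>\<^bsub>L\<^esub> (z \<otimes>\<^bsub>L\<^esub> x)) \<oplus>\<^bsub>L\<^esub> (z \<otimes>\<^bsub>L\<^esub> (x \<otimes>\<^bsub>L\<^esub> y)) = \<zero>\<^bsub>L\<^esub>"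

record ('r, 'v, 'g) lie_module = "('r, 'v) module" +
  act :: "'g \<Rightarrow> 'v \<Rightarrow> 'v"

locale lie_module = lie_algebra R L + V: module R V
  for R :: "('r, 'a) ring_scheme" (structure) and L :: "('r, 'g, 'b) module_scheme" (structure)
    and V :: "('r, 'v, 'g, 'c) lie_module_scheme" +
  assumes act_closed:
      "\<lbrakk>x \<in> carrier L; v \<in> carrier V\<rbrakk> \<Longrightarrow> act V x v \<in> carrier V"
    and act_add_left:
      "\<lbrakk>x \<in> carrier L; y \<in> carrier L; v \<in> carrier V\<rbrakk>
        \<Longrightarrow> act V (x \<oplus>\<^bsub>L\<^esub> y) v = act V x v \<oplus>\<^bsub>V\<^esub> act V y v"
    and act_smult_left:
      "\<lbrakk>c \<in> carrier R; x \<in> carrier L; v \<in> carrier V\<rbrakk>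
        \<Longrightarrow> act V (c \<odot>\<^bsub>L\<^esub> x) v = c \<odot>\<^bsub>V\<^esub> act V x v"
    and act_add_right:
      "\<lbrakk>x \<in> carrier L; v \<in> carrier V; w \<in> carrier V\<rbrakk>
        \<Longrightarrow> act V x (v \<oplus>\<^bsub>V\<^esub> w) = act V x v \<oplus>\<^bsub>V\<^esub> act V x w"
    and act_smult_right:
      "\<lbrakk>c \<in> carrier R; x \<in> carrier L; v \<in> carrier V\<rbrakk>
        \<Longrightarrow> act V x (c \<odot>\<^bsub>V\<^esub> v) = c \<odot>\<^bsub>V\<^esub> act V x v"
    and act_bracket:
      "\<lbrakk>x \<in> carrier L; y \<in> carrier L; v \<in> carrier V\<rbrakk>
        \<Longrightarrow> act V (x \<otimes>\<^bsub>L\<^esub> y) v = act V x (act V y v) \<ominus>\<^bsub>V\<^esub> act V y (act V x v)"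

definition lie_submodule ::
  "('r, 'a) ring_scheme \<Rightarrow> ('r, 'g, 'b) module_scheme \<Rightarrow> ('r, 'v, 'g, 'c) lie_module_scheme
    \<Rightarrow> 'v set \<Rightarrow> bool"
  where "lie_submodule R L V W \<longleftrightarrow>
    lie_module R L V \<and> submodule W R V \<and> (\<forall>x\<in>carrier L. \<forall>w\<in>W. act V x w \<in> W)"

definition simple_lie_module ::
  "('r, 'a) ring_scheme \<Rightarrow> ('r, 'g, 'b) module_scheme \<Rightarrow> ('r, 'v, 'g, 'c) lie_module_scheme \<Rightarrow> bool"
  where "simple_lie_module R L V \<longleftrightarrow>
    lie_module R L V \<and> carrier V \<noteq> {\<zero>\<^bsub>V\<^esub>} \<and>
    (\<forall>W. lie_submodule R L V W \<longrightarrow> W = {\<zero>\<^bsub>V\<^esub>} \<or> W = carrier V)"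

definition lie_module_iso ::
  "('r, 'a) ring_scheme \<Rightarrow> ('r, 'g, 'b) module_scheme \<Rightarrow> ('r, 'v, 'g, 'c) lie_module_scheme
    \<Rightarrow> ('r, 'w, 'g, 'd) lie_module_scheme \<Rightarrow> ('v \<Rightarrow> 'w) \<Rightarrow> bool"
  where "lie_module_iso R L V W \<phi> \<longleftrightarrow>
    lie_module R L V \<and> lie_module R L W \<and>
    bij_betw \<phi> (carrier V) (carrier W) \<and>
    (\<forall>u\<in>carrier V. \<forall>v\<in>carrier V. \<phi> (u \<oplus>\<^bsub>V\<^esub> v) = \<phi> u \<oplus>\<^bsub>W\<^esub> \<phi> v) \<and>
    (\<forall>c\<in>carrier R. \<forall>v\<in>carrier V. \<phi> (c \<odot>\<^bsub>V\<^esub> v) = c \<odot>\<^bsub>W\<^esub> \<phi> v) \<and>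
    (\<forall>x\<in>carrier L. \<forall>v\<in>carrier V. \<phi> (act V x v) = act W x (\<phi> v))"

definition lie_module_isomorphic ::
  "('r, 'a) ring_scheme \<Rightarrow> ('r, 'g, 'b) module_scheme \<Rightarrow> ('r, 'v, 'g, 'c) lie_module_scheme
    \<Rightarrow> ('r, 'w, 'g, 'd) lie_module_scheme \<Rightarrow> bool"
  where "lie_module_isomorphic R L V W \<longleftrightarrow> (\<exists>\<phi>. lie_module_iso R L V W \<phi>)"

text \<open>
  The quotient \<open>V / W\<close> on the set of cosets of \<open>W\<close>. For a Lie submodule \<open>W\<close> the sets of which the
  union is taken in \<open>smult\<close> and \<open>act\<close> all coincide, for \<open>x\<close> ranging over a coset \<open>C\<close>.
\<close>

definition lie_quotient :: "('r, 'v, 'g) lie_module \<Rightarrow> 'v set \<Rightarrow> ('r, 'v set, 'g) lie_module"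
  where "lie_quotient V W =
    \<lparr>carrier = a_rcosets\<^bsub>V\<^esub> W, monoid.mult = undefined, one = undefined,
     zero = W, add = set_add V,
     module.smult = (\<lambda>c C. \<Union>x\<in>C. W +>\<^bsub>V\<^esub> (c \<odot>\<^bsub>V\<^esub> x)),
     act = (\<lambda>g C. \<Union>x\<in>C. W +>\<^bsub>V\<^esub> act V g x)\<rparr>"

definition one_dimensional :: "('r, 'a) ring_scheme \<Rightarrow> ('r, 'v, 'b) module_scheme \<Rightarrow> bool"
  where "one_dimensional R V \<longleftrightarrow>
    (\<exists>v\<in>carrier V. v \<noteq> \<zero>\<^bsub>V\<^esub> \<and> (\<forall>x\<in>carrier V. \<exists>c\<in>carrier R. x = c \<odot>\<^bsub>V\<^esub> v))"

definition trivial_lie_module ::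
  "('r, 'a) ring_scheme \<Rightarrow> ('r, 'g, 'b) module_scheme \<Rightarrow> ('r, 'v, 'g, 'c) lie_module_scheme \<Rightarrow> bool"
  where "trivial_lie_module R L V \<longleftrightarrow>
    lie_module R L V \<and> (\<forall>x\<in>carrier L. \<forall>v\<in>carrier V. act V x v = \<zero>\<^bsub>V\<^esub>)"

abbreviation complex_ring :: "complex ring"
  where "complex_ring \<equiv> ring_of_type_algebra"


section \<open>The Lie algebra $\mathcal{HV}(a,b;1)$\<close>

datatype hv_index = L_idx int nat | H_idx int nat

type_synonym hv = "hv_index \<Rightarrow>\<^sub>0 complex"

definition hv_scale :: "complex \<Rightarrow> hv \<Rightarrow> hv"
  where "hv_scale c x = Poly_Mapping.map ((*) c) x"

text \<open>
  For \<open>m = n = 0\<close> the truncated subtraction \<open>m + n - 1\<close> is harmless, since the coefficient of that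
  term is \<open>0\<close>.
\<close>

fun hv_basis_bracket :: "complex \<Rightarrow> complex \<Rightarrow> hv_index \<Rightarrow> hv_index \<Rightarrow> hv"
  where
    "hv_basis_bracket a b (L_idx i m) (L_idx j n) =
       Poly_Mapping.single (L_idx (i + j) (m + n)) (of_int (j - i))
       - Poly_Mapping.single (L_idx (i + j) (m + n - 1)) (of_nat n - of_nat m)"
  | "hv_basis_bracket a b (L_idx i m) (H_idx j n) =
       Poly_Mapping.single (H_idx (i + j) (m + n)) (a + of_int j + b * of_int i)
       - Poly_Mapping.single (H_idx (i + j) (m + n - 1)) (of_nat n + b * of_nat m)"
  | "hv_basis_bracket a b (H_idx j n) (L_idx i m) =
       - (Poly_Mapping.single (H_idx (i + j) (m + n)) (a + of_int j + b * of_int i)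
          - Poly_Mapping.single (H_idx (i + j) (m + n - 1)) (of_nat n + b * of_nat m))"
  | "hv_basis_bracket a b (H_idx i m) (H_idx j n) = 0"

definition hv_bracket :: "complex \<Rightarrow> complex \<Rightarrow> hv \<Rightarrow> hv \<Rightarrow> hv"
  where "hv_bracket a b x y =
    (\<Sum>p\<in>Poly_Mapping.keys x. \<Sum>q\<in>Poly_Mapping.keys y.
       hv_scale (Poly_Mapping.lookup x p * Poly_Mapping.lookup y q) (hv_basis_bracket a b p q))"

definition HV :: "complex \<Rightarrow> complex \<Rightarrow> (complex, hv) module"
  where "HV a b =
    \<lparr>carrier = UNIV, monoid.mult = hv_bracket a b, one = undefined,
     zero = 0, add = (+), module.smult = hv_scale\<rparr>"


section \<open>The modules $\Omega_{\mathfrak g}(\lambda,\alpha,\beta,\gamma)$\<close>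

definition gamma_exists :: "complex \<Rightarrow> complex \<Rightarrow> bool"
  where "gamma_exists a b \<longleftrightarrow> b = 0 \<or> (b = 1 \<and> a \<noteq> 0)"

text \<open>\<open>deriv_shift s c f\<close> is the polynomial $f^{(s)}(t - c)$.\<close>

definition deriv_shift :: "nat \<Rightarrow> complex \<Rightarrow> complex poly \<Rightarrow> complex poly"
  where "deriv_shift s c f = pcompose ((pderiv ^^ s) f) [:- c, 1:]"

definition omega_L ::
  "complex \<Rightarrow> complex \<Rightarrow> complex \<Rightarrow> int \<Rightarrow> nat \<Rightarrow> complex poly \<Rightarrow> complex poly"
  where "omega_L lam \<alpha> \<beta> i m f =
    (\<Sum>s\<le>m. Polynomial.smult (of_nat (m choose s) * lam powi i)
       ((Polynomial.smult (\<beta> ^ (m - s)) [:- (of_int i * \<alpha>), 1:]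
         + [:of_nat (m - s) * \<alpha> * \<beta> ^ (m - s - 1):])
        * deriv_shift s (of_int i) f))"

text \<open>
  The standing assumption $0 \le \mathrm{Re}\,a < 1$ together with \<open>a \<noteq> 0\<close> keeps the denominators
  \<open>a + i\<close> below away from \<open>0\<close>. Powers with a natural exponent follow the convention $0^0 = 1$.
\<close>

definition omega_H ::
  "complex \<Rightarrow> complex \<Rightarrow> complex \<Rightarrow> complex \<Rightarrow> complex \<Rightarrow> int \<Rightarrow> nat \<Rightarrow> complex poly \<Rightarrow> complex poly"
  where "omega_H a b lam \<beta> \<gamma> i m f =
    (if b = 0 then
       \<Sum>s\<le>m. Polynomial.smult (of_nat (m choose s) * lam powi i * \<beta> ^ (m - s) * \<gamma>)
         (deriv_shift s (a + of_int i) f)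
     else if b = 1 \<and> a \<noteq> 0 then
       \<Sum>s\<le>m. \<Sum>l\<le>m - s. Polynomial.smult
         (fact (m - s) / fact (m - s - l) * of_nat (m choose s)
          * (a * lam powi i * \<beta> ^ (m - s - l) * \<gamma> / (a + of_int i) ^ (l + 1)))
         (deriv_shift s (a + of_int i) f)
     else 0)"

fun omega_basis_act ::
  "complex \<Rightarrow> complex \<Rightarrow> complex \<Rightarrow> complex \<Rightarrow> complex \<Rightarrow> complex
    \<Rightarrow> hv_index \<Rightarrow> complex poly \<Rightarrow> complex poly"
  where
    "omega_basis_act a b lam \<alpha> \<beta> \<gamma> (L_idx i m) f = omega_L lam \<alpha> \<beta> i m f"
  | "omega_basis_act a b lam \<alpha> \<beta> \<gamma> (H_idx i m) f = omega_H a b lam \<beta> \<gamma> i m f"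

definition Omega ::
  "complex \<Rightarrow> complex \<Rightarrow> complex \<Rightarrow> complex \<Rightarrow> complex \<Rightarrow> complex
    \<Rightarrow> (complex, complex poly, hv) lie_module"
  where "Omega a b lam \<alpha> \<beta> \<gamma> =
    \<lparr>carrier = UNIV, monoid.mult = undefined, one = undefined,
     zero = 0, add = (+), module.smult = Polynomial.smult,
     act = (\<lambda>x f. \<Sum>p\<in>Poly_Mapping.keys x.
       Polynomial.smult (Poly_Mapping.lookup x p) (omega_basis_act a b lam \<alpha> \<beta> \<gamma> p f))\<rparr>"

text \<open>The subspace $t\,\mathbb{C}[t]$.\<close>

definition t_multiples :: "complex poly set"
  where "t_multiples = range (\<lambda>f. [:0, 1:] * f)"

end

theory Submission
  imports Defs
begin

text \<open>
  Put \<open>P = d/dt + \<beta>\<close> and let \<open>S\<^sub>c\<close> be the shift \<open>f(t) \<mapsto> f(t - c)\<close>; these commute, \<open>[P, t] = 1\<close> and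
  \<open>S\<^sub>c t = (t - c) S\<^sub>c\<close>. The binomial theorem turns the action into
  \<open>L\<^bsub>i,m\<^esub> = \<lambda>\<^sup>i ((t - i\<alpha>) P\<^sup>m + m \<alpha> P\<^bsup>m-1\<^esup>) S\<^sub>i\<close>, and \<open>H\<^bsub>i,m\<^esub> = \<gamma> \<lambda>\<^sup>i P\<^sup>m S\<^bsub>a+i\<^esub>\<close> for \<open>b = 0\<close>, while for
  \<open>b = 1\<close> the double sum is the solution of
  \<open>(a + i) H\<^bsub>i,m\<^esub> = m H\<^bsub>i,m-1\<^esub> + a \<gamma> \<lambda>\<^sup>i P\<^sup>m S\<^bsub>a+i\<^esub>\<close>. So the module axioms are identities in a Weyl
  algebra extended by shifts.

  As \<open>L\<^bsub>0,0\<^esub>\<close> is multiplication by \<open>t\<close>, submodules are ideals \<open>(g)\<close> of \<open>\<complex>[t]\<close>, and \<open>g\<close> divides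
  \<open>(t - i\<alpha>) g(t - i)\<close> for all \<open>i\<close>. Only finitely many integer translates of \<open>g\<close> share a root with \<open>g\<close>,
  which forces \<open>g\<close> to be constant, or \<open>\<alpha> = 0\<close> and \<open>g\<close> to be a multiple of \<open>t\<close> by a constant; a nonzero \<open>\<gamma>\<close>
  makes \<open>g\<close> divide all \<open>g(t - a - i)\<close> and rules out the latter. Likewise an isomorphism is
  \<open>\<complex>[t]\<close>-linear, hence a nonzero scalar, so isomorphic modules have equal actions, and the parameters
  are read off from \<open>L\<^bsub>0,1\<^esub>\<close>, \<open>L\<^bsub>1,0\<^esub>\<close> and \<open>H\<^bsub>0,0\<^esub>\<close> applied to \<open>1\<close>.
\<close>

section \<open>The Lie algebra\<close>

lemma vector_space_hv_scale: "vector_space hv_scale"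
  by unfold_locales
    (auto simp: hv_scale_def map.rep_eq when_def lookup_add ring_distribs
      simp flip: distrib_left intro!: poly_mapping_eqI)

lemma vector_space_smult: "vector_space (Polynomial.smult :: complex \<Rightarrow> complex poly \<Rightarrow> complex poly)"
  by unfold_locales (auto simp: smult_add_right smult_add_left)

interpretation hv: vector_space hv_scale
  by (rule vector_space_hv_scale)

lemma lookup_hv_scale [simp]: "Poly_Mapping.lookup (hv_scale c x) p = c * Poly_Mapping.lookup x p"
  by (simp add: hv_scale_def map.rep_eq when_def)

lemma single_eq_hv_scale: "Poly_Mapping.single p c = hv_scale c (Poly_Mapping.single p 1)"
  by (rule poly_mapping_eqI) (simp add: lookup_single when_def)

text \<open>An element is the finite sum of its scaled basis vectors, so linear statements reduce to
  the basis. The zero element is the case \<open>c = 0\<close> of the first hypothesis.\<close>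

lemma hv_induct [case_names single add]:
  fixes x :: hv
  assumes "\<And>p c. P (hv_scale c (Poly_Mapping.single p 1))" and "\<And>x y. P x \<Longrightarrow> P y \<Longrightarrow> P (x + y)"
  shows "P x"
proof -
  have "P (\<Sum>p\<in>A. Poly_Mapping.single p (Poly_Mapping.lookup x p))" if "finite A" for A
    using that
  proof induction
    case empty
    show ?case using assms(1)[of 0] by simp
  next
    case (insert q A)
    have "P (Poly_Mapping.single q (Poly_Mapping.lookup x q))"
      by (subst single_eq_hv_scale) (rule assms(1))
    then show ?case using insert assms(2) by simp
  qed
  moreover have "(\<Sum>p\<in>Poly_Mapping.keys x. Poly_Mapping.single p (Poly_Mapping.lookup x p)) = x"
    by (rule poly_mapping_eqI) (simp add: lookup_sum lookup_single when_def in_keys_iff)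
  ultimately show ?thesis by (metis finite_keys)
qed

text \<open>The scalar multiplication is an argument, so that the bracket and the action on
  polynomials are both instances.\<close>

definition lin_ext :: "(complex \<Rightarrow> 'v \<Rightarrow> 'v) \<Rightarrow> (hv_index \<Rightarrow> 'v::ab_group_add) \<Rightarrow> hv \<Rightarrow> 'v"
  where "lin_ext s f x = (\<Sum>p\<in>Poly_Mapping.keys x. s (Poly_Mapping.lookup x p) (f p))"

text \<open>Cancellation makes the supports of \<open>x\<close>, \<open>y\<close> and
  \<open>x + y\<close> differ; a common index set lets their sums be compared termwise.\<close>

lemma lin_ext_superset:
  assumes "vector_space s" "finite A" "Poly_Mapping.keys x \<subseteq> A"
  shows "lin_ext s f x = (\<Sum>p\<in>A. s (Poly_Mapping.lookup x p) (f p))"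
proof -
  interpret vector_space s by fact
  show ?thesis
    unfolding lin_ext_def using assms
    by (intro sum.mono_neutral_left) (auto simp: in_keys_iff)
qed

lemma lin_ext_single:
  assumes "vector_space s"
  shows "lin_ext s f (Poly_Mapping.single p c) = s c (f p)"
proof -
  interpret vector_space s by fact
  show ?thesis by (subst lin_ext_superset[OF assms, of "{p}"]) auto
qed

lemma lin_ext_add:
  assumes "vector_space s"
  shows "lin_ext s f (x + y) = lin_ext s f x + lin_ext s f y"
proof -
  interpret vector_space s by fact
  let ?A = "Poly_Mapping.keys x \<union> Poly_Mapping.keys y"
  have "Poly_Mapping.keys (x + y) \<subseteq> ?A" by (rule keys_add)
  then show ?thesis
    by (simp add: lin_ext_superset[OF assms, of ?A] lookup_add scale_left_distrib sum.distrib)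
qed

lemma lin_ext_scale:
  assumes "vector_space s"
  shows "lin_ext s f (hv_scale c x) = s c (lin_ext s f x)"
proof -
  interpret vector_space s by fact
  have "Poly_Mapping.keys (hv_scale c x) \<subseteq> Poly_Mapping.keys x"
    by (auto simp: in_keys_iff)
  then show ?thesis
    by (simp add: lin_ext_superset[OF assms, of "Poly_Mapping.keys x"] scale_sum_right)
qed

section \<open>Bilinearity, antisymmetry and the Jacobi identity\<close>

lemma hv_bracket_eq_lin_ext:
  "hv_bracket a b x y = lin_ext hv_scale (\<lambda>p. lin_ext hv_scale (hv_basis_bracket a b p) y) x"
  by (simp add: hv_bracket_def lin_ext_def hv.scale_sum_right)

lemma hv_bracket_add_left: "hv_bracket a b (x + y) z = hv_bracket a b x z + hv_bracket a b y z"
  by (simp add: hv_bracket_eq_lin_ext lin_ext_add[OF vector_space_hv_scale])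

lemma hv_bracket_scale_left: "hv_bracket a b (hv_scale c x) z = hv_scale c (hv_bracket a b x z)"
  by (simp add: hv_bracket_eq_lin_ext lin_ext_scale[OF vector_space_hv_scale])

lemma hv_bracket_add_right: "hv_bracket a b x (y + z) = hv_bracket a b x y + hv_bracket a b x z"
  by (simp add: hv_bracket_eq_lin_ext lin_ext_add[OF vector_space_hv_scale])
    (simp add: lin_ext_def hv.scale_right_distrib sum.distrib)

lemma hv_bracket_scale_right: "hv_bracket a b x (hv_scale c y) = hv_scale c (hv_bracket a b x y)"
  by (simp add: hv_bracket_eq_lin_ext lin_ext_scale[OF vector_space_hv_scale])
    (simp add: lin_ext_def hv.scale_sum_right mult.left_commute)

lemma hv_bracket_single:
  "hv_bracket a b (Poly_Mapping.single p c) (Poly_Mapping.single q d)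
     = hv_scale c (hv_scale d (hv_basis_bracket a b p q))"
  by (simp add: hv_bracket_eq_lin_ext lin_ext_single[OF vector_space_hv_scale])

lemma hv_bracket_diff_right: "hv_bracket a b x (y - z) = hv_bracket a b x y - hv_bracket a b x z"
  by (metis hv_bracket_add_right add_diff_cancel_right' diff_add_cancel)

lemma hv_bracket_zero_right: "hv_bracket a b x 0 = 0"
  using hv_bracket_diff_right[of a b x 0 0] by simp

lemma hv_bracket_uminus_right: "hv_bracket a b x (- y) = - hv_bracket a b x y"
  using hv_bracket_diff_right[of a b x 0 y] by (simp add: hv_bracket_zero_right)

lemma hv_basis_bracket_anti: "hv_basis_bracket a b p q = - hv_basis_bracket a b q p"
  by (cases p; cases q; rule poly_mapping_eqI)
    (simp_all add: lookup_minus lookup_single when_def add.commute)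

lemma hv_bracket_anti: "hv_bracket a b x y = - hv_bracket a b y x"
proof (induction x rule: hv_induct)
  case (single p c)
  show ?case
    by (induction y rule: hv_induct)
      (simp_all add: hv_bracket_add_left hv_bracket_add_right hv_bracket_scale_left
        hv_bracket_scale_right hv_bracket_single hv_basis_bracket_anti[of a b p] hv.scale_right_distrib mult.commute)
qed (simp add: hv_bracket_add_left hv_bracket_add_right)

text \<open>Antisymmetry makes twice the bracket vanish, and 2 is invertible in the field.\<close>

lemma hv_bracket_self: "hv_bracket a b x x = 0"
proof -
  have "hv_scale 2 (hv_bracket a b x x) = hv_bracket a b x x + hv_bracket a b x x"
    using hv.scale_left_distrib[of 1 1 "hv_bracket a b x x"] by simp
  also have "\<dots> = 0" using hv_bracket_anti[of a b x x] by (metis add.right_inverse)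
  finally show ?thesis by simp
qed

lemma hv_jacobi_basis:
  fixes p q r :: hv_index
  defines "e \<equiv> \<lambda>p. Poly_Mapping.single p (1 :: complex)"
  shows "hv_bracket a b (e p) (hv_bracket a b (e q) (e r))
    + hv_bracket a b (e q) (hv_bracket a b (e r) (e p))
    + hv_bracket a b (e r) (hv_bracket a b (e p) (e q)) = 0"
    (is "?J p q r = 0")
proof -
  \<comment> \<open>Compared coefficientwise, the identities become polynomial in the parameters and
    the atoms \<open>\<delta> k u\<close>, without case splits on equality of indices.\<close>
  define \<delta> where "\<delta> = (\<lambda>k u :: hv_index. if k = u then 1 else 0 :: complex)"
  have lookup: "Poly_Mapping.lookup (Poly_Mapping.single k c) u = c * \<delta> k u" for k c u
    by (simp add: \<delta>_def lookup_single when_def)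
  note expand = e_def hv_bracket_single hv_bracket_diff_right hv_bracket_uminus_right
    hv_bracket_zero_right lookup lookup_add lookup_minus add_ac
  \<comment> \<open>Splitting the second indices evaluates the truncated subtractions; wherever one
    is cut off, its coefficient is zero.\<close>
  have LLL: "?J (L_idx i m) (L_idx j n) (L_idx k l) = 0" for i j k m n l
    by (cases m; cases n; cases l; rule poly_mapping_eqI) (simp_all add: expand, simp_all add: algebra_simps)
  have LLH: "?J (L_idx i m) (L_idx j n) (H_idx k l) = 0" for i j k m n l
    by (cases m; cases n; cases l; rule poly_mapping_eqI) (simp_all add: expand, simp_all add: algebra_simps)
  have LHH: "?J (L_idx i m) (H_idx j n) (H_idx k l) = 0" for i j k m n l
    by (simp add: expand)
  have HHH: "?J (H_idx i m) (H_idx j n) (H_idx k l) = 0" for i j k m n l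
    by (simp add: expand)
  \<comment> \<open>The sum is invariant under rotation, which brings each of the eight kinds of
    triple to one of the four computed.\<close>
  have cyc: "?J p q r = ?J q r p" for p q r
    by (simp only: add_ac)
  note rot = trans[OF cyc]
  show ?thesis
    by (cases p; cases q; cases r; hypsubst)
      (rule LLL LLH LHH HHH rot[OF LLH] rot[OF LHH] rot[OF rot[OF LLH]] rot[OF rot[OF LHH]])+
qed

text \<open>The sum is linear in each argument, so three nested inductions reduce it to basis
  vectors.\<close>

lemma hv_jacobi:
  "hv_bracket a b x (hv_bracket a b y z) + hv_bracket a b y (hv_bracket a b z x)
    + hv_bracket a b z (hv_bracket a b x y) = 0"
proof -
  note linear = hv_bracket_add_left hv_bracket_add_right hv_bracket_scale_left hv_bracket_scale_right
  have distr: "hv_scale c u + hv_scale c v + hv_scale c w = hv_scale c (u + v + w)" for c u v w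
    by (simp add: hv.scale_right_distrib)
  have regroup: "u + v + w = 0 \<Longrightarrow> u' + v' + w' = 0 \<Longrightarrow> u + u' + (v + v') + (w + w') = 0"
    for u v w u' v' w' :: hv
    by (metis (no_types, lifting) add.assoc add.left_commute add.right_neutral)
  show ?thesis
  proof (induction x rule: hv_induct)
    case (single p c)
    have "hv_bracket a b (Poly_Mapping.single p 1) (hv_bracket a b y z)
        + hv_bracket a b y (hv_bracket a b z (Poly_Mapping.single p 1))
        + hv_bracket a b z (hv_bracket a b (Poly_Mapping.single p 1) y) = 0"
    proof (induction y rule: hv_induct)
      case (single q d)
      have "hv_bracket a b (Poly_Mapping.single p 1) (hv_bracket a b (Poly_Mapping.single q 1) z)
          + hv_bracket a b (Poly_Mapping.single q 1) (hv_bracket a b z (Poly_Mapping.single p 1))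
          + hv_bracket a b z (hv_bracket a b (Poly_Mapping.single p 1) (Poly_Mapping.single q 1)) = 0"
      proof (induction z rule: hv_induct)
        case (single r k)
        show ?case
          by (simp only: linear distr hv_jacobi_basis hv.scale_zero_right)
      next
        case (add x y)
        then show ?case by (simp only: linear regroup)
      qed
      then show ?case by (simp only: linear distr hv.scale_zero_right)
    next
      case (add x y)
      then show ?case by (simp only: linear regroup)
    qed
    then show ?case by (simp only: linear distr hv.scale_zero_right)
  next
    case (add x y)
    then show ?case by (simp only: linear regroup)
  qed
qed

lemma cring_complex_ring: "cring complex_ring"
  by (rule cring_from_type_algebra)

lemma lie_algebra_HV: "lie_algebra complex_ring (HV a b)"
proof -
  have "abelian_group (HV a b)"
    by (rule abelian_groupI) (auto simp: HV_def add_ac intro: exI[of _ "- _"])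
  then have "Module.module complex_ring (HV a b)"
    by (intro moduleI cring_complex_ring)
      (auto simp: HV_def ring_of_type_algebra_def hv.scale_left_distrib hv.scale_right_distrib)
  then show ?thesis
    by (intro lie_algebra.intro lie_algebra_axioms.intro)
      (auto simp: HV_def ring_of_type_algebra_def hv_bracket_add_left hv_bracket_add_right
        hv_bracket_scale_left hv_bracket_scale_right hv_bracket_self hv_jacobi)
qed

section \<open>Shifts and twisted derivatives\<close>

definition shift :: "complex \<Rightarrow> complex poly \<Rightarrow> complex poly"
  where "shift c f = pcompose f [:- c, 1:]"

text \<open>This is d/dt conjugated by multiplication with exp(\<beta> t).\<close>

definition twist_deriv :: "complex \<Rightarrow> complex poly \<Rightarrow> complex poly"
  where "twist_deriv \<beta> f = pderiv f + Polynomial.smult \<beta> f"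

definition twist_shift :: "complex \<Rightarrow> complex \<Rightarrow> nat \<Rightarrow> complex poly \<Rightarrow> complex poly"
  where "twist_shift \<beta> c m f = (twist_deriv \<beta> ^^ m) (shift c f)"

lemma poly_eqI_poly: "(\<And>x. poly p x = poly q x) \<Longrightarrow> p = (q :: complex poly)"
  by (simp add: ext flip: poly_eq_poly_eq_iff)

lemma shift_shift: "shift c (shift d f) = shift (c + d) f"
  by (rule poly_eqI_poly) (simp add: shift_def poly_pcompose algebra_simps)

lemma pderiv_shift: "pderiv (shift c f) = shift c (pderiv f)"
  by (simp add: shift_def pderiv_pcompose pderiv_pCons)

lemma twist_deriv_shift: "twist_deriv \<beta> (shift c f) = shift c (twist_deriv \<beta> f)"
  by (simp add: twist_deriv_def pderiv_shift) (simp add: shift_def pcompose_add pcompose_smult)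

lemma twist_deriv_pow_shift: "(twist_deriv \<beta> ^^ m) (shift c f) = shift c ((twist_deriv \<beta> ^^ m) f)"
  by (induction m) (simp_all add: twist_deriv_shift)

lemma twist_deriv_pow_add:
  "(twist_deriv \<beta> ^^ m) (f + g) = (twist_deriv \<beta> ^^ m) f + (twist_deriv \<beta> ^^ m) g"
  by (induction m) (simp_all add: twist_deriv_def pderiv_add smult_add_right)

lemma twist_deriv_pow_smult:
  "(twist_deriv \<beta> ^^ m) (Polynomial.smult c f) = Polynomial.smult c ((twist_deriv \<beta> ^^ m) f)"
  by (induction m) (simp_all add: twist_deriv_def pderiv_smult smult_add_right mult.commute)

text \<open>The twisted derivative has commutator 1 with \<open>t + u\<close>, hence its
  \<open>m\<close>-th power has \<open>m\<close> times the power \<open>m - 1\<close>.\<close>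

lemma twist_deriv_pow_mult_linear:
  "(twist_deriv \<beta> ^^ m) ([:u, 1:] * f)
     = [:u, 1:] * (twist_deriv \<beta> ^^ m) f + Polynomial.smult (of_nat m) ((twist_deriv \<beta> ^^ (m - 1)) f)"
proof (induction m)
  case (Suc m)
  have "twist_deriv \<beta> ([:u, 1:] * g) = [:u, 1:] * twist_deriv \<beta> g + g" for g
    by (rule poly_eqI_poly)
      (simp add: twist_deriv_def pderiv_mult pderiv_pCons pderiv_add pderiv_smult algebra_simps)
  moreover have "twist_deriv \<beta> (g + h) = twist_deriv \<beta> g + twist_deriv \<beta> h"
      "twist_deriv \<beta> (Polynomial.smult c g) = Polynomial.smult c (twist_deriv \<beta> g)" for g h c
    using twist_deriv_pow_add[of 1] twist_deriv_pow_smult[of 1] by simp_all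
  ultimately have "(twist_deriv \<beta> ^^ Suc m) ([:u, 1:] * f)
      = [:u, 1:] * twist_deriv \<beta> ((twist_deriv \<beta> ^^ m) f) + (twist_deriv \<beta> ^^ m) f
        + Polynomial.smult (of_nat m) (twist_deriv \<beta> ((twist_deriv \<beta> ^^ (m - 1)) f))"
    by (simp only: funpow.simps comp_apply Suc)
  \<comment> \<open>For \<open>m = 0\<close> both sides vanish with the factor
    \<open>of_nat m\<close>, so the truncated exponent is harmless.\<close>
  also have "Polynomial.smult (of_nat m) (twist_deriv \<beta> ((twist_deriv \<beta> ^^ (m - 1)) f))
      = Polynomial.smult (of_nat m) ((twist_deriv \<beta> ^^ m) f)"
    by (cases m) simp_all
  finally show ?case
    by (simp add: smult_add_left add_ac del: mult_pCons_left)
qed simp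

lemma twist_shift_add: "twist_shift \<beta> c m (f + g) = twist_shift \<beta> c m f + twist_shift \<beta> c m g"
  by (simp add: twist_shift_def shift_def pcompose_add twist_deriv_pow_add)

lemma twist_shift_smult:
  "twist_shift \<beta> c m (Polynomial.smult k f) = Polynomial.smult k (twist_shift \<beta> c m f)"
  by (simp add: twist_shift_def shift_def pcompose_smult twist_deriv_pow_smult)

lemma twist_shift_twist_shift:
  "twist_shift \<beta> c m (twist_shift \<beta> d n f) = twist_shift \<beta> (c + d) (m + n) f"
  by (simp add: twist_shift_def shift_shift funpow_add flip: twist_deriv_pow_shift)

lemma twist_shift_mult_linear:
  "twist_shift \<beta> c m ([:u, 1:] * f)
     = [:u - c, 1:] * twist_shift \<beta> c m f + Polynomial.smult (of_nat m) (twist_shift \<beta> c (m - 1) f)"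
proof -
  have "shift c ([:u, 1:] * f) = [:u - c, 1:] * shift c f"
    by (rule poly_eqI_poly) (simp add: shift_def poly_pcompose algebra_simps)
  then show ?thesis
    by (simp only: twist_shift_def twist_deriv_pow_mult_linear)
qed

lemma smult_sum_right:
  "Polynomial.smult c (sum g A) = (\<Sum>x\<in>A. Polynomial.smult c (g x :: complex poly))"
  by (induction A rule: infinite_finite_induct) (simp_all add: smult_add_right)

text \<open>The binomial theorem for the commuting operators d/dt and multiplication by \<beta>, by
  induction with Pascal's rule.\<close>

lemma twist_deriv_pow_eq_sum:
  "(twist_deriv \<beta> ^^ m) f
     = (\<Sum>s\<le>m. Polynomial.smult (of_nat (m choose s) * \<beta> ^ (m - s)) ((pderiv ^^ s) f))"
proof (induction m)
  case (Suc m)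
  let ?D = "\<lambda>s. (pderiv ^^ s) f"
  have deriv_sum: "pderiv (\<Sum>s\<le>m. Polynomial.smult (c s) (?D s))
      = (\<Sum>s\<le>m. Polynomial.smult (c s) (?D (Suc s)))" for c
    by (induction m) (simp_all add: pderiv_add pderiv_smult)
  have "(\<Sum>s\<le>Suc m. Polynomial.smult (of_nat (Suc m choose s) * \<beta> ^ (Suc m - s)) (?D s))
      = Polynomial.smult (\<beta> ^ Suc m) f
        + (\<Sum>s\<le>m. Polynomial.smult (of_nat (m choose s) * \<beta> ^ (m - s)) (?D (Suc s)))
        + (\<Sum>s\<le>m. Polynomial.smult (of_nat (m choose Suc s) * \<beta> ^ (m - s)) (?D (Suc s)))"
    by (subst sum.atMost_Suc_shift)
      (simp add: algebra_simps smult_add_left sum.distrib)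
  \<comment> \<open>The sum can be extended to \<open>s = Suc m\<close>, as
    \<open>m choose Suc m\<close> is 0; afterwards its first term is split off.\<close>
  moreover have "(\<Sum>s\<le>m. Polynomial.smult (\<beta> * (of_nat (m choose s) * \<beta> ^ (m - s))) (?D s))
      = (\<Sum>s\<le>Suc m. Polynomial.smult (of_nat (m choose s) * \<beta> ^ (Suc m - s)) (?D s))"
    by (simp add: Suc_diff_le algebra_simps)
  moreover have "\<dots> = Polynomial.smult (\<beta> ^ Suc m) f
        + (\<Sum>s\<le>m. Polynomial.smult (of_nat (m choose Suc s) * \<beta> ^ (m - s)) (?D (Suc s)))"
    by (subst sum.atMost_Suc_shift) simp
  moreover have "(twist_deriv \<beta> ^^ Suc m) f
      = pderiv ((twist_deriv \<beta> ^^ m) f) + Polynomial.smult \<beta> ((twist_deriv \<beta> ^^ m) f)"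
    by (simp add: twist_deriv_def)
  ultimately show ?case
    unfolding Suc deriv_sum by (simp only: smult_sum_right smult_smult add_ac)
qed simp

section \<open>Closed forms and a recursion for the basis operators\<close>

lemma twist_shift_eq_sum:
  "twist_shift \<beta> c m f
     = (\<Sum>s\<le>m. Polynomial.smult (of_nat (m choose s) * \<beta> ^ (m - s)) (deriv_shift s c f))"
proof -
  have "(pderiv ^^ s) (shift c f) = deriv_shift s c f" for s
    by (induction s) (simp_all add: pderiv_shift deriv_shift_def flip: shift_def)
  then show ?thesis
    by (simp add: twist_shift_def twist_deriv_pow_eq_sum)
qed

text \<open>Absorption replaces the weight depending on \<open>s\<close> by a constant factor; it
  serves the \<alpha>-part of \<open>omega_L\<close> and the factorials in
  \<open>omega_H_rec\<close>.\<close>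

lemma binomial_shift:
  assumes "s \<le> m"
  shows "(of_nat (Suc m choose s) * of_nat (Suc m - s) :: complex) = of_nat (Suc m) * of_nat (m choose s)"
  using binomial_absorb_comp[of "Suc m" s]
  by (metis diff_Suc_1 mult.commute of_nat_mult)

lemma omega_L_eq:
  "omega_L lam \<alpha> \<beta> i m f = Polynomial.smult (lam powi i)
     ([:- (of_int i * \<alpha>), 1:] * twist_shift \<beta> (of_int i) m f
      + Polynomial.smult (of_nat m * \<alpha>) (twist_shift \<beta> (of_int i) (m - 1) f))"
proof -
  let ?D = "\<lambda>s. deriv_shift s (of_int i) f"
  have "omega_L lam \<alpha> \<beta> i m f = Polynomial.smult (lam powi i)
      ([:- (of_int i * \<alpha>), 1:] * (\<Sum>s\<le>m. Polynomial.smult (of_nat (m choose s) * \<beta> ^ (m - s)) (?D s))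
       + (\<Sum>s\<le>m. Polynomial.smult (of_nat (m choose s) * of_nat (m - s) * \<alpha> * \<beta> ^ (m - s - 1)) (?D s)))"
    unfolding omega_L_def sum_distrib_left smult_sum_right sum.distrib[symmetric]
    by (intro sum.cong refl poly_eqI_poly) (simp_all add: algebra_simps)
  also have "(\<Sum>s\<le>m. Polynomial.smult (of_nat (m choose s) * of_nat (m - s) * \<alpha> * \<beta> ^ (m - s - 1)) (?D s))
      = Polynomial.smult (of_nat m * \<alpha>) (twist_shift \<beta> (of_int i) (m - 1) f)"
  proof (cases m)
    case (Suc n)
    \<comment> \<open>The term \<open>s = m\<close> carries the factor \<open>m - s = 0\<close>, so
      the range shrinks to that of the power \<open>m - 1\<close>.\<close>
    have "(\<Sum>s\<le>m. Polynomial.smult (of_nat (m choose s) * of_nat (m - s) * \<alpha> * \<beta> ^ (m - s - 1)) (?D s))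
        = (\<Sum>s\<le>n. Polynomial.smult (of_nat (m choose s) * of_nat (m - s) * \<alpha> * \<beta> ^ (m - s - 1)) (?D s))"
      by (simp add: Suc)
    also have "\<dots> = (\<Sum>s\<le>n. Polynomial.smult (of_nat m * \<alpha> * (of_nat (n choose s) * \<beta> ^ (n - s))) (?D s))"
      by (intro sum.cong refl arg_cong2[where f = Polynomial.smult])
        (simp only: Suc binomial_shift atMost_iff, simp add: algebra_simps)
    finally show ?thesis
      by (simp add: Suc twist_shift_eq_sum smult_sum_right)
  qed simp
  finally show ?thesis
    by (simp only: twist_shift_eq_sum)
qed

lemma omega_H_eq_0:
  "omega_H a 0 lam \<beta> \<gamma> i m f = Polynomial.smult (lam powi i * \<gamma>) (twist_shift \<beta> (a + of_int i) m f)"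
  unfolding omega_H_def twist_shift_eq_sum by (simp add: smult_sum_right algebra_simps)

text \<open>The coefficient at level \<open>m\<close> with index \<open>l + 1\<close> is
  \<open>m / (a + i)\<close> times the one at level \<open>m - 1\<close> with index
  \<open>l\<close>, and the terms with \<open>l = 0\<close> add up to the twisted power. The
  commutator proofs use this recursion in place of the double sum.\<close>

lemma omega_H_rec:
  assumes "a \<noteq> 0" "a + of_int i \<noteq> 0"
  shows "Polynomial.smult (a + of_int i) (omega_H a 1 lam \<beta> \<gamma> i m f)
    = Polynomial.smult (of_nat m) (omega_H a 1 lam \<beta> \<gamma> i (m - 1) f)
      + Polynomial.smult (a * lam powi i * \<gamma>) (twist_shift \<beta> (a + of_int i) m f)"
proof -
  let ?c = "a + of_int i" and ?D = "\<lambda>s. deriv_shift s (a + of_int i) f"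
  define T where "T m s l = fact (m - s) / fact (m - s - l) * of_nat (m choose s)
          * (a * lam powi i * \<beta> ^ (m - s - l) * \<gamma> / (a + of_int i) ^ (l + 1))" for m s l
  have H: "omega_H a 1 lam \<beta> \<gamma> i m f = (\<Sum>s\<le>m. \<Sum>l\<le>m - s. Polynomial.smult (T m s l) (?D s))" for m
    using assms by (simp add: omega_H_def T_def)
  have T0: "?c * T m s 0 = a * lam powi i * \<gamma> * (of_nat (m choose s) * \<beta> ^ (m - s))" for m s
    using assms by (simp add: T_def)
  have TSuc: "?c * T (Suc n) s (Suc l) = of_nat (Suc n) * T n s l" if "s \<le> n" for n s l
  proof -
    have "fact (Suc n - s) * of_nat (Suc n choose s)
        = (of_nat (Suc n) * (fact (n - s) * of_nat (n choose s)) :: complex)"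
      using arg_cong[OF binomial_shift[OF that], of "\<lambda>x. fact (n - s) * x"] that
      by (simp add: Suc_diff_le mult_ac del: of_nat_Suc)
    then have "T (Suc n) s (Suc l) = of_nat (Suc n) * (fact (n - s) * of_nat (n choose s))
        * (a * lam powi i * \<beta> ^ (n - s - l) * \<gamma>) / (fact (n - s - l) * ?c ^ (l + 2))"
      unfolding T_def by simp
    then show ?thesis
      using assms unfolding T_def by simp
  qed
  show ?thesis
  proof (cases m)
    case 0
    then show ?thesis
      by (simp add: H twist_shift_eq_sum T0)
  next
    case (Suc n)
    have "Polynomial.smult ?c (\<Sum>s\<le>m. \<Sum>l\<le>m - s. Polynomial.smult (T m s l) (?D s))
        = (\<Sum>s\<le>m. \<Sum>l\<le>m - s. Polynomial.smult (?c * T m s l) (?D s))"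
      by (simp add: smult_sum_right)
    \<comment> \<open>The row \<open>s = m\<close> consists of its \<open>l = 0\<close> term alone;
      in the other rows the upper bound is a successor, so the \<open>l = 0\<close> term splits
      off.\<close>
    also have "\<dots> = (\<Sum>s\<le>n. \<Sum>l\<le>Suc (n - s). Polynomial.smult (?c * T m s l) (?D s))
        + Polynomial.smult (?c * T m m 0) (?D m)"
      by (simp add: Suc Suc_diff_le)
    also have "(\<Sum>s\<le>n. \<Sum>l\<le>Suc (n - s). Polynomial.smult (?c * T m s l) (?D s))
        = (\<Sum>s\<le>n. Polynomial.smult (?c * T m s 0) (?D s))
          + (\<Sum>s\<le>n. \<Sum>l\<le>n - s. Polynomial.smult (?c * T m s (Suc l)) (?D s))"
      by (simp only: sum.atMost_Suc_shift sum.distrib)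
    also have "(\<Sum>s\<le>n. \<Sum>l\<le>n - s. Polynomial.smult (?c * T m s (Suc l)) (?D s))
        = (\<Sum>s\<le>n. \<Sum>l\<le>n - s. Polynomial.smult (of_nat m * T n s l) (?D s))"
      by (intro sum.cong refl arg_cong2[where f = Polynomial.smult])
        (simp only: Suc TSuc atMost_iff)
    finally show ?thesis
      unfolding H twist_shift_eq_sum T0 by (simp add: Suc smult_sum_right smult_add_right T0 del: of_nat_Suc)
  qed
qed

lemma omega_basis_act_add:
  "omega_basis_act a b lam \<alpha> \<beta> \<gamma> p (f + g)
     = omega_basis_act a b lam \<alpha> \<beta> \<gamma> p f + omega_basis_act a b lam \<alpha> \<beta> \<gamma> p g"
proof -
  have "deriv_shift s c (f + g) = deriv_shift s c f + deriv_shift s c g" for s c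
    unfolding deriv_shift_def pcompose_add[symmetric]
    by (rule arg_cong[where f = "\<lambda>h. pcompose h _"]) (induction s, simp_all add: pderiv_add)
  then show ?thesis
    by (cases p) (simp_all add: omega_L_def omega_H_def ring_distribs smult_add_right sum.distrib
      del: mult_smult_left mult_smult_right mult_pCons_left)
qed

lemma omega_basis_act_smult:
  "omega_basis_act a b lam \<alpha> \<beta> \<gamma> p (Polynomial.smult k f)
     = Polynomial.smult k (omega_basis_act a b lam \<alpha> \<beta> \<gamma> p f)"
proof -
  have "deriv_shift s c (Polynomial.smult k f) = Polynomial.smult k (deriv_shift s c f)" for s c
    unfolding deriv_shift_def pcompose_smult[symmetric]
    by (rule arg_cong[where f = "\<lambda>h. pcompose h _"]) (induction s, simp_all add: pderiv_smult)
  then show ?thesis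
    by (cases p; intro poly_eqI_poly)
      (simp_all add: omega_L_eq twist_shift_smult omega_H_def poly_sum sum_distrib_left algebra_simps)
qed

section \<open>Commutation relations of the basis operators\<close>

lemmas twist_shift_simps = twist_shift_add twist_shift_smult twist_shift_twist_shift twist_shift_mult_linear

lemma nat_cases_012:
  obtains "m = 0" | "m = Suc 0" | k where "m = Suc (Suc k)"
  by (metis not0_implies_Suc)

text \<open>Moving \<open>t\<close> to the left of the twisted shifts leaves sums of
  \<open>twist_shift\<close> terms with polynomial coefficients on both sides. Powers lowered by one
  and by two occur, hence the split of \<open>m\<close> and \<open>n\<close> into 0, 1 and
  larger.\<close>

lemma omega_L_commutator:
  assumes "lam \<noteq> 0"
  shows "omega_L lam \<alpha> \<beta> i m (omega_L lam \<alpha> \<beta> j n f) - omega_L lam \<alpha> \<beta> j n (omega_L lam \<alpha> \<beta> i m f)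
    = Polynomial.smult (of_int (j - i)) (omega_L lam \<alpha> \<beta> (i + j) (m + n) f)
      - Polynomial.smult (of_nat n - of_nat m) (omega_L lam \<alpha> \<beta> (i + j) (m + n - 1) f)"
  by (cases m rule: nat_cases_012; cases n rule: nat_cases_012; rule poly_eqI_poly)
    (simp_all add: omega_L_eq twist_shift_simps power_int_add assms add_ac del: mult_pCons_left,
     simp_all add: algebra_simps)

text \<open>Up to a scalar these operators are the action of \<open>H_idx j n\<close> for
  \<open>b = 0\<close> and the inhomogeneous term of \<open>omega_H_rec\<close> for
  \<open>b = 1\<close>, so one computation serves both cases.\<close>

lemma omega_L_twist_shift_commutator:
  assumes "lam \<noteq> 0"
  shows "omega_L lam \<alpha> \<beta> i m (Polynomial.smult (lam powi j) (twist_shift \<beta> (a + of_int j) n f))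
      - Polynomial.smult (lam powi j) (twist_shift \<beta> (a + of_int j) n (omega_L lam \<alpha> \<beta> i m f))
    = Polynomial.smult (a + of_int j)
        (Polynomial.smult (lam powi (i + j)) (twist_shift \<beta> (a + of_int (i + j)) (m + n) f))
      - Polynomial.smult (of_nat n)
        (Polynomial.smult (lam powi (i + j)) (twist_shift \<beta> (a + of_int (i + j)) (m + n - 1) f))"
  by (cases m rule: nat_cases_012; cases n rule: nat_cases_012; rule poly_eqI_poly)
    (simp_all add: omega_L_eq twist_shift_simps power_int_add assms add_ac del: mult_pCons_left,
     simp_all add: algebra_simps)

lemma omega_L_add: "omega_L lam \<alpha> \<beta> i m (f + g) = omega_L lam \<alpha> \<beta> i m f + omega_L lam \<alpha> \<beta> i m g"
  using omega_basis_act_add[where p = "L_idx i m"] by simp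

lemma omega_L_smult: "omega_L lam \<alpha> \<beta> i m (Polynomial.smult k f) = Polynomial.smult k (omega_L lam \<alpha> \<beta> i m f)"
  using omega_basis_act_smult[where p = "L_idx i m"] by simp

lemma omega_H_add:
  "omega_H a b lam \<beta> \<gamma> i m (f + g) = omega_H a b lam \<beta> \<gamma> i m f + omega_H a b lam \<beta> \<gamma> i m g"
  using omega_basis_act_add[where p = "H_idx i m"] by simp

lemma omega_H_smult:
  "omega_H a b lam \<beta> \<gamma> i m (Polynomial.smult k f) = Polynomial.smult k (omega_H a b lam \<beta> \<gamma> i m f)"
  using omega_basis_act_smult[where p = "H_idx i m"] by simp

lemma omega_H_trivial: "\<not> (gamma_exists a b \<and> \<gamma> \<noteq> 0) \<Longrightarrow> omega_H a b lam \<beta> \<gamma> i m f = 0"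
  by (auto simp: omega_H_def gamma_exists_def)

text \<open>Otherwise \<open>a\<close> would be an integer in [0, 1), hence 0.\<close>

lemma add_of_int_neq_0:
  assumes "0 \<le> Re a" "Re a < 1" "a \<noteq> 0"
  shows "a + of_int i \<noteq> 0"
proof
  assume "a + of_int i = 0"
  then have a: "a = of_int (- i)" by (simp add: eq_neg_iff_add_eq_0)
  then have "Re a = of_int (- i)" by simp
  with assms(1,2) have "i = 0" by linarith
  with a assms(3) show False by simp
qed

lemma smult_cancel_left: "c \<noteq> 0 \<Longrightarrow> Polynomial.smult c f = Polynomial.smult c g \<Longrightarrow> f = (g :: complex poly)"
  by (metis smult_smult left_inverse smult_1_left)

text \<open>By \<open>omega_H_rec\<close> the right side is the bracket prescribed for
  \<open>b = 1\<close>, written so that \<open>m\<close> and \<open>n\<close> enter only through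
  their sum. This form suits induction on \<open>n\<close>.\<close>

lemma omega_L_omega_H_1_commutator:
  assumes "0 \<le> Re a" "Re a < 1" "a \<noteq> 0" "lam \<noteq> 0"
  shows "omega_L lam \<alpha> \<beta> i m (omega_H a 1 lam \<beta> \<gamma> j n f) - omega_H a 1 lam \<beta> \<gamma> j n (omega_L lam \<alpha> \<beta> i m f)
    = Polynomial.smult (a * \<gamma>) (Polynomial.smult (lam powi (i + j)) (twist_shift \<beta> (a + of_int (i + j)) (m + n) f))"
proof -
  let ?L = "omega_L lam \<alpha> \<beta> i m" and ?H = "omega_H a 1 lam \<beta> \<gamma> j"
  define K where "K = (\<lambda>j n f. Polynomial.smult (lam powi j) (twist_shift \<beta> (a + of_int j) n f))"
  have comm: "?L (K j n f) - K j n (?L f)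
      = Polynomial.smult (a + of_int j) (K (i + j) (m + n) f)
        - Polynomial.smult (of_nat n) (K (i + j) (m + n - 1) f)" for n
    unfolding K_def by (rule omega_L_twist_shift_commutator[OF assms(4)])
  let ?S = Polynomial.smult
  have c: "a + of_int j \<noteq> 0" using assms add_of_int_neq_0 by blast
  have rec: "?S (a + of_int j) (?H n f) = ?S (of_nat n) (?H (n - 1) f) + ?S (a * \<gamma>) (K j n f)" for n f
    using omega_H_rec[OF assms(3) c, of lam \<beta> \<gamma> n f] by (simp add: K_def mult_ac)
  \<comment> \<open>Commuting \<open>?L\<close> with the recursion for \<open>?H\<close> gives a
    recursion in \<open>n\<close> for the commutator itself.\<close>
  have step: "?S (a + of_int j) (?L (?H n f) - ?H n (?L f))
      = ?S (of_nat n) (?L (?H (n - 1) f) - ?H (n - 1) (?L f))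
        + ?S (a * \<gamma>) (?S (a + of_int j) (K (i + j) (m + n) f) - ?S (of_nat n) (K (i + j) (m + n - 1) f))" for n
  proof -
    have "?S (a + of_int j) (?L (?H n f) - ?H n (?L f))
        = ?L (?S (a + of_int j) (?H n f)) - ?S (a + of_int j) (?H n (?L f))"
      by (simp only: omega_L_smult smult_diff_right)
    also have "\<dots> = ?S (of_nat n) (?L (?H (n - 1) f) - ?H (n - 1) (?L f))
        + ?S (a * \<gamma>) (?L (K j n f) - K j n (?L f))"
      by (simp only: rec omega_L_add omega_L_smult smult_diff_right add_diff_add)
    finally show ?thesis by (simp only: comm)
  qed
  have goal: "?L (?H n f) - ?H n (?L f) = ?S (a * \<gamma>) (K (i + j) (m + n) f)" for n
  proof (induction n)
    case 0
    show ?case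
      by (rule smult_cancel_left[OF c]) (unfold step, simp add: mult_ac)
  next
    \<comment> \<open>The lower commutator, known by induction, cancels the subtracted term and
      leaves \<open>a + j\<close> times the claim.\<close>
    case (Suc n)
    show ?case
      by (rule smult_cancel_left[OF c])
        (unfold step diff_Suc_1 Suc, simp add: smult_diff_right mult_ac)
  qed
  then show ?thesis by (simp add: K_def)
qed

lemma omega_L_omega_H_commutator:
  assumes "0 \<le> Re a" "Re a < 1" "lam \<noteq> 0"
  shows "omega_L lam \<alpha> \<beta> i m (omega_H a b lam \<beta> \<gamma> j n f) - omega_H a b lam \<beta> \<gamma> j n (omega_L lam \<alpha> \<beta> i m f)
    = Polynomial.smult (a + of_int j + b * of_int i) (omega_H a b lam \<beta> \<gamma> (i + j) (m + n) f)
      - Polynomial.smult (of_nat n + b * of_nat m) (omega_H a b lam \<beta> \<gamma> (i + j) (m + n - 1) f)"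
proof -
  consider "b = 0" | "b = 1" "a \<noteq> 0" | "\<not> gamma_exists a b"
    by (auto simp: gamma_exists_def)
  then show ?thesis
  proof cases
    case 1
    define K where "K = (\<lambda>j n f. Polynomial.smult (lam powi j) (twist_shift \<beta> (a + of_int j) n f))"
    have comm: "omega_L lam \<alpha> \<beta> i m (K j n f) - K j n (omega_L lam \<alpha> \<beta> i m f)
        = Polynomial.smult (a + of_int j) (K (i + j) (m + n) f)
          - Polynomial.smult (of_nat n) (K (i + j) (m + n - 1) f)"
      unfolding K_def by (rule omega_L_twist_shift_commutator[OF assms(3)])
    have H: "omega_H a b lam \<beta> \<gamma> j n f = Polynomial.smult \<gamma> (K j n f)" for j n f
      by (simp add: 1 K_def omega_H_eq_0 mult.commute)
    show ?thesis
      unfolding H omega_L_smult smult_diff_right[symmetric] comm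
      by (simp add: 1 smult_diff_right mult_ac)
  next
    case 2
    \<comment> \<open>The claim is now the recursion at first index \<open>i + j\<close> and level
      \<open>m + n\<close>.\<close>
    have "a + of_int (i + j) \<noteq> 0" using assms 2 add_of_int_neq_0 by blast
    from omega_H_rec[OF 2(2) this, of lam \<beta> \<gamma> "m + n" f] show ?thesis
      unfolding 2(1) omega_L_omega_H_1_commutator[OF assms(1,2) 2(2) assms(3)]
      by (simp add: algebra_simps)
  next
    case 3
    then show ?thesis
      using omega_L_smult[of lam \<alpha> \<beta> i m 0 0] by (simp add: omega_H_trivial)
  qed
qed

lemma omega_H_commute:
  assumes "0 \<le> Re a" "Re a < 1"
  shows "omega_H a b lam \<beta> \<gamma> i m (omega_H a b lam \<beta> \<gamma> j n f) = omega_H a b lam \<beta> \<gamma> j n (omega_H a b lam \<beta> \<gamma> i m f)"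
proof -
  consider "b = 0" | "b = 1" "a \<noteq> 0" | "\<not> gamma_exists a b"
    by (auto simp: gamma_exists_def)
  then show ?thesis
  proof cases
    case 1
    then show ?thesis
      by (simp add: omega_H_eq_0 twist_shift_simps add_ac mult_ac)
  next
    case 2
    let ?H = "omega_H a 1 lam \<beta> \<gamma>" and ?R = "twist_shift \<beta>" and ?S = Polynomial.smult
    have c: "a + of_int i \<noteq> 0" for i using assms 2 add_of_int_neq_0 by blast
    note rec = omega_H_rec[OF 2(2) c]
    \<comment> \<open>The operators \<open>?R\<close> commute with each other, so by the recursion
      \<open>?H\<close> commutes with \<open>?R\<close>; a second induction then gives
      \<open>?H\<close> with \<open>?H\<close>.\<close>
    have HR: "?H i m (?R d n f) = ?R d n (?H i m f)" for i m d n f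
    proof (induction m)
      case 0
      show ?case
        by (rule smult_cancel_left[OF c[of i]])
          (simp add: rec flip: twist_shift_smult, simp add: twist_shift_simps add_ac)
    next
      case (Suc m)
      show ?case
        by (rule smult_cancel_left[OF c[of i]], unfold twist_shift_smult[symmetric] rec diff_Suc_1)
          (simp only: twist_shift_simps Suc add_ac)
    qed
    have "?H i m (?H j n f) = ?H j n (?H i m f)"
    proof (induction n)
      case 0
      show ?case
        by (rule smult_cancel_left[OF c[of j]], unfold omega_H_smult[of a 1 lam \<beta> \<gamma> i, symmetric] rec)
          (simp add: omega_H_smult omega_H_add HR)
    next
      case (Suc n)
      show ?case
        by (rule smult_cancel_left[OF c[of j]], unfold omega_H_smult[of a 1 lam \<beta> \<gamma> i, symmetric] rec)
          (simp add: omega_H_smult omega_H_add HR Suc)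
    qed
    then show ?thesis by (simp add: 2)
  next
    case 3
    then show ?thesis by (simp add: omega_H_trivial)
  qed
qed

section \<open>The module structure\<close>

definition omega_act where
  "omega_act a b lam \<alpha> \<beta> \<gamma> x f = lin_ext Polynomial.smult (\<lambda>p. omega_basis_act a b lam \<alpha> \<beta> \<gamma> p f) x"

lemma act_Omega: "act (Omega a b lam \<alpha> \<beta> \<gamma>) = omega_act a b lam \<alpha> \<beta> \<gamma>"
  by (simp add: fun_eq_iff Omega_def omega_act_def lin_ext_def)

lemma omega_act_add_left:
  "omega_act a b lam \<alpha> \<beta> \<gamma> (x + y) f = omega_act a b lam \<alpha> \<beta> \<gamma> x f + omega_act a b lam \<alpha> \<beta> \<gamma> y f"
  by (simp add: omega_act_def lin_ext_add[OF vector_space_smult])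

lemma omega_act_scale_left:
  "omega_act a b lam \<alpha> \<beta> \<gamma> (hv_scale c x) f = Polynomial.smult c (omega_act a b lam \<alpha> \<beta> \<gamma> x f)"
  by (simp add: omega_act_def lin_ext_scale[OF vector_space_smult])

lemma omega_act_add_right:
  "omega_act a b lam \<alpha> \<beta> \<gamma> x (f + g) = omega_act a b lam \<alpha> \<beta> \<gamma> x f + omega_act a b lam \<alpha> \<beta> \<gamma> x g"
  by (simp add: omega_act_def lin_ext_def omega_basis_act_add smult_add_right sum.distrib)

lemma omega_act_smult_right:
  "omega_act a b lam \<alpha> \<beta> \<gamma> x (Polynomial.smult c f) = Polynomial.smult c (omega_act a b lam \<alpha> \<beta> \<gamma> x f)"
  by (simp add: omega_act_def lin_ext_def omega_basis_act_smult smult_sum_right mult.commute)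

lemma omega_act_single:
  "omega_act a b lam \<alpha> \<beta> \<gamma> (Poly_Mapping.single p c) f = Polynomial.smult c (omega_basis_act a b lam \<alpha> \<beta> \<gamma> p f)"
  by (simp add: omega_act_def lin_ext_single[OF vector_space_smult])

lemma omega_act_diff_left:
  "omega_act a b lam \<alpha> \<beta> \<gamma> (x - y) f = omega_act a b lam \<alpha> \<beta> \<gamma> x f - omega_act a b lam \<alpha> \<beta> \<gamma> y f"
  by (metis omega_act_add_left add_diff_cancel_right' diff_add_cancel)

lemma omega_act_0_left: "omega_act a b lam \<alpha> \<beta> \<gamma> 0 f = 0"
  by (simp add: omega_act_def lin_ext_def)

lemma omega_act_basis_bracket:
  assumes "0 \<le> Re a" "Re a < 1" "lam \<noteq> 0"
  shows "omega_act a b lam \<alpha> \<beta> \<gamma> (hv_basis_bracket a b p q) f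
    = omega_basis_act a b lam \<alpha> \<beta> \<gamma> p (omega_basis_act a b lam \<alpha> \<beta> \<gamma> q f)
      - omega_basis_act a b lam \<alpha> \<beta> \<gamma> q (omega_basis_act a b lam \<alpha> \<beta> \<gamma> p f)"
proof (cases p; cases q)
  fix i m j n
  assume pq: "p = H_idx j n" "q = L_idx i m"
  have "omega_act a b lam \<alpha> \<beta> \<gamma> (- x) f = - omega_act a b lam \<alpha> \<beta> \<gamma> x f" for x
    using omega_act_diff_left[of a b lam \<alpha> \<beta> \<gamma> 0 x f] by (simp add: omega_act_0_left)
  then show ?thesis
    using omega_L_omega_H_commutator[OF assms, of \<alpha> \<beta> i m b \<gamma> j n f]
    by (simp add: pq omega_act_diff_left omega_act_single algebra_simps)
qed (simp_all add: omega_act_diff_left omega_act_0_left omega_act_single omega_H_commute[OF assms(1,2)]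
    omega_L_commutator[OF assms(3)] omega_L_omega_H_commutator[OF assms])

lemma omega_act_bracket:
  assumes "0 \<le> Re a" "Re a < 1" "lam \<noteq> 0"
  shows "omega_act a b lam \<alpha> \<beta> \<gamma> (hv_bracket a b x y) f
    = omega_act a b lam \<alpha> \<beta> \<gamma> x (omega_act a b lam \<alpha> \<beta> \<gamma> y f)
      - omega_act a b lam \<alpha> \<beta> \<gamma> y (omega_act a b lam \<alpha> \<beta> \<gamma> x f)"
proof (induction x rule: hv_induct)
  case (single p c)
  show ?case
  proof (induction y rule: hv_induct)
    case (single q d)
    show ?case
      by (simp add: hv_bracket_scale_left hv_bracket_scale_right hv_bracket_single omega_act_scale_left
          omega_act_smult_right omega_act_single omega_act_basis_bracket[OF assms] smult_diff_right mult.commute)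
  qed (simp add: hv_bracket_add_right omega_act_add_left omega_act_add_right)
qed (simp add: hv_bracket_add_left omega_act_add_left omega_act_add_right)

text \<open>Subtraction in the record is defined by the inverse in its additive monoid, which refers
  to the carrier; so \<open>- y\<close> must lie there.\<close>

lemma a_minus_eq:
  assumes "abelian_group V" "add V = (+)" "zero V = (0 :: 'v :: ab_group_add)"
    "x \<in> carrier V" "y \<in> carrier V" "- y \<in> carrier V"
  shows "x \<ominus>\<^bsub>V\<^esub> y = x - y"
proof -
  interpret abelian_group V by fact
  have "\<ominus>\<^bsub>V\<^esub> y = - y"
    by (rule minus_equality) (use assms in auto)
  then show ?thesis using assms by (simp add: a_minus_def)
qed

text \<open>Stated for a closed subset, it covers \<open>Omega\<close> with \<open>W = UNIV\<close>
  as well as its submodule \<open>t_multiples\<close>.\<close>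

lemma lie_module_Omega_restrict:
  assumes "0 \<le> Re a" "Re a < 1" "lam \<noteq> 0"
    and W: "0 \<in> W" "\<And>f g. f \<in> W \<Longrightarrow> g \<in> W \<Longrightarrow> f + g \<in> W" "\<And>c f. f \<in> W \<Longrightarrow> Polynomial.smult c f \<in> W"
      "\<And>x f. f \<in> W \<Longrightarrow> omega_act a b lam \<alpha> \<beta> \<gamma> x f \<in> W"
  shows "lie_module complex_ring (HV a b) (Omega a b lam \<alpha> \<beta> \<gamma>\<lparr>carrier := W\<rparr>)"
    (is "lie_module _ _ ?V")
proof -
  have uminus: "- f \<in> W" if "f \<in> W" for f
    using W(3)[of f "-1"] that by simp
  have group: "abelian_group ?V"
    by (rule abelian_groupI)
      (use W uminus in \<open>auto simp: Omega_def add_ac intro: bexI[of _ "- _"]\<close>)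
  then have "Module.module complex_ring ?V"
    by (intro moduleI cring_complex_ring)
      (use W in \<open>auto simp: Omega_def ring_of_type_algebra_def smult_add_left smult_add_right\<close>)
  moreover have "lie_module_axioms complex_ring (HV a b) ?V"
  proof (rule lie_module_axioms.intro, goal_cases)
    \<comment> \<open>The sixth axiom is \<open>act_bracket\<close>, the only one with a
      subtraction.\<close>
    case (6 x y v)
    have minus: "v' \<ominus>\<^bsub>?V\<^esub> v'' = v' - v''" if "v' \<in> W" "v'' \<in> W" for v' v''
      by (rule a_minus_eq[OF group]) (use that uminus in \<open>auto simp: Omega_def\<close>)
    have actV: "act ?V = omega_act a b lam \<alpha> \<beta> \<gamma>"
      using act_Omega by (simp add: Omega_def)
    have "v \<in> W" using 6 by simp
    then show ?case
      unfolding actV by (subst minus) (auto intro!: W simp: HV_def omega_act_bracket[OF assms(1-3)])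
  qed (use W act_Omega[of a b lam \<alpha> \<beta> \<gamma>] in \<open>simp_all add: Omega_def HV_def omega_act_add_left omega_act_add_right
      omega_act_scale_left omega_act_smult_right\<close>)
  ultimately show ?thesis
    by (intro lie_module.intro lie_algebra_HV)
qed

lemma lie_module_Omega:
  assumes "0 \<le> Re a" "Re a < 1" "lam \<noteq> 0"
  shows "lie_module complex_ring (HV a b) (Omega a b lam \<alpha> \<beta> \<gamma>)"
  using lie_module_Omega_restrict[OF assms, of UNIV b \<alpha> \<beta> \<gamma>] by (simp add: Omega_def)

section \<open>Submodules\<close>

lemma carrier_Omega [simp]: "carrier (Omega a b lam \<alpha> \<beta> \<gamma>) = UNIV"
  and zero_Omega [simp]: "\<zero>\<^bsub>Omega a b lam \<alpha> \<beta> \<gamma>\<^esub> = 0"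
  and add_Omega [simp]: "f \<oplus>\<^bsub>Omega a b lam \<alpha> \<beta> \<gamma>\<^esub> g = f + g"
  and smult_Omega [simp]: "c \<odot>\<^bsub>Omega a b lam \<alpha> \<beta> \<gamma>\<^esub> f = Polynomial.smult c f"
  and carrier_HV [simp]: "carrier (HV a b) = UNIV"
  and carrier_complex_ring [simp]: "carrier complex_ring = UNIV"
  by (simp_all add: Omega_def HV_def ring_of_type_algebra_def)

text \<open>Under either assumption all \<open>H_idx\<close> act as zero.\<close>

lemma Omega_gamma_irrelevant:
  assumes "\<not> (gamma_exists a b \<and> \<gamma> \<noteq> 0)" "\<not> (gamma_exists a b \<and> \<gamma>' \<noteq> 0)"
  shows "Omega a b lam \<alpha> \<beta> \<gamma> = Omega a b lam \<alpha> \<beta> \<gamma>'"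
proof -
  have "omega_basis_act a b lam \<alpha> \<beta> \<gamma> p f = omega_basis_act a b lam \<alpha> \<beta> \<gamma>' p f" for p f
    by (cases p) (simp_all add: omega_H_trivial[OF assms(1)] omega_H_trivial[OF assms(2)])
  then show ?thesis by (simp add: Omega_def)
qed

lemma twist_shift_zero_power: "twist_shift \<beta> c 0 f = shift c f"
  by (simp add: twist_shift_def)

lemma omega_L_zero: "omega_L lam \<alpha> \<beta> i 0 f = Polynomial.smult (lam powi i) ([:- (of_int i * \<alpha>), 1:] * shift (of_int i) f)"
  by (simp add: omega_L_eq twist_shift_zero_power)

lemma omega_L_0_0: "omega_L lam \<alpha> \<beta> 0 0 f = [:0, 1:] * f"
  by (simp add: omega_L_zero) (simp add: shift_def)

lemma t_multiples_iff: "f \<in> t_multiples \<longleftrightarrow> poly f 0 = 0"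
proof -
  have "f \<in> t_multiples \<longleftrightarrow> [:0, 1:] dvd f"
    by (simp only: t_multiples_def dvd_def image_iff bex_UNIV)
  then show ?thesis
    using poly_eq_0_iff_dvd[of f 0] by simp
qed

text \<open>With \<alpha> = 0 every \<open>L_idx\<close> operator has the left factor
  \<open>t\<close>, and with \<gamma> = 0 every \<open>H_idx\<close> operator is zero. This makes
  \<open>t_multiples\<close> a submodule and the action on the quotient trivial.\<close>

lemma omega_act_in_t_multiples: "omega_act a b lam 0 \<beta> 0 x f \<in> t_multiples"
proof -
  have "poly (omega_basis_act a b lam 0 \<beta> 0 p f) 0 = 0" for p
    by (cases p) (simp_all add: omega_L_eq omega_H_trivial)
  then show ?thesis
    by (simp add: t_multiples_iff omega_act_def lin_ext_def poly_sum)
qed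

section \<open>Submodules as ideals of the polynomial ring\<close>

locale omega_submodule =
  fixes a b lam \<alpha> \<beta> \<gamma> :: complex and W :: "complex poly set"
  assumes W: "lie_submodule complex_ring (HV a b) (Omega a b lam \<alpha> \<beta> \<gamma>) W"
begin

lemma subspace:
  shows zero: "0 \<in> W" and add: "\<And>f g. f \<in> W \<Longrightarrow> g \<in> W \<Longrightarrow> f + g \<in> W"
    and smult: "\<And>c f. f \<in> W \<Longrightarrow> Polynomial.smult c f \<in> W"
proof -
  have sub: "submodule W complex_ring (Omega a b lam \<alpha> \<beta> \<gamma>)"
    using W by (simp add: lie_submodule_def)
  then have group: "subgroup W (add_monoid (Omega a b lam \<alpha> \<beta> \<gamma>))"
    by (rule submodule.axioms)
  show "0 \<in> W" using subgroup.one_closed[OF group] by simp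
  show "f + g \<in> W" if "f \<in> W" "g \<in> W" for f g
    using subgroup.m_closed[OF group that] by simp
  show "Polynomial.smult c f \<in> W" if "f \<in> W" for c f
    using submodule.smult_closed[OF sub _ that, of c] by simp
qed

lemma basis_act: "f \<in> W \<Longrightarrow> omega_basis_act a b lam \<alpha> \<beta> \<gamma> p f \<in> W"
  using W omega_act_single[of a b lam \<alpha> \<beta> \<gamma> p 1 f]
  by (metis lie_submodule_def act_Omega carrier_HV UNIV_I smult_1_left)

lemma mult: "f \<in> W \<Longrightarrow> p * f \<in> W"
proof (induction p)
  case (pCons c p)
  have "[:0, 1:] * (p * f) \<in> W"
    using basis_act[of "p * f" "L_idx 0 0"] pCons by (simp add: omega_L_0_0)
  moreover have "Polynomial.smult c f \<in> W" using smult pCons.prems .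
  ultimately show ?case using add by (simp add: mult_pCons_left)
qed (simp add: zero)

text \<open>Division with remainder shows that a nonzero element of least degree generates the
  ideal.\<close>

lemma principal:
  assumes "W \<noteq> {0}"
  obtains g where "g \<noteq> 0" "\<And>f. f \<in> W \<longleftrightarrow> g dvd f"
proof -
  obtain f where "f \<in> W \<and> f \<noteq> 0" using assms zero by auto
  from ex_has_least_nat[of "\<lambda>f. f \<in> W \<and> f \<noteq> 0", OF this, of degree]
  obtain g where g: "g \<in> W \<and> g \<noteq> 0" and min: "\<And>f. f \<in> W \<and> f \<noteq> 0 \<Longrightarrow> degree g \<le> degree f"
    by blast
  have "g dvd f" if "f \<in> W" for f
  proof -
    have "f mod g = f + (- (f div g)) * g" by (simp flip: minus_div_mult_eq_mod)
    then have "f mod g \<in> W" using add[OF that mult] g by metis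
    then show ?thesis
      using min[of "f mod g"] degree_mod_less'[of g f] g by (fastforce simp: mod_eq_0_iff_dvd)
  qed
  moreover have "f \<in> W" if "g dvd f" for f
    using that mult[of g] g by (auto simp: dvd_def mult.commute)
  ultimately show ?thesis using g that by blast
qed

end

section \<open>Roots of a generator\<close>

lemma ex_int_not_root:
  fixes g :: "complex poly"
  assumes "g \<noteq> 0" "finite E"
  shows "\<exists>i :: int. i \<notin> E \<and> poly g (z - of_int i) \<noteq> 0"
proof -
  have "finite ((\<lambda>i. z - of_int i) -` {x. poly g x = 0})"
    using poly_roots_finite[OF assms(1)] by (rule finite_vimageI) (simp add: inj_def)
  then have "finite (E \<union> (\<lambda>i. z - of_int i) -` {x. poly g x = 0})" using assms(2) by simp
  from ex_new_if_finite[OF infinite_UNIV_int this] show ?thesis by auto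
qed

lemma unit_if_no_root: "(\<And>z. poly g z \<noteq> 0) \<Longrightarrow> g dvd (1 :: complex poly)"
proof -
  assume nr: "\<And>z. poly g z \<noteq> 0"
  have "degree g = 0"
    using fundamental_theorem_of_algebra[of g] nr by (auto simp: constant_degree)
  then obtain c where "g = [:c:]" by (rule degree_eq_zeroE)
  then show ?thesis using nr[of 0] by (simp add: is_unit_const_poly_iff dvd_field_iff)
qed

lemma poly_root_of_dvd: "g dvd f \<Longrightarrow> poly g z = 0 \<Longrightarrow> poly f z = (0 :: complex)"
  by (auto elim: dvdE)

lemma poly_shift: "poly (shift c f) x = poly f (x - c)"
  by (simp add: shift_def poly_pcompose)

context omega_submodule
begin

lemma generator_dvd_shift:
  assumes "lam \<noteq> 0" "\<And>f. f \<in> W \<longleftrightarrow> g dvd f"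
  shows "g dvd [:- (of_int i * \<alpha>), 1:] * shift (of_int i) g"
  using basis_act[of g "L_idx i 0"] assms by (simp add: omega_L_zero dvd_smult_iff)

text \<open>Evaluating the divisibility at \<open>z\<close> gives
  \<open>(z - i \<alpha>) g(z - i) = 0\<close> for every integer \<open>i\<close>. Two different
  \<open>i\<close> with nonzero second factor give \<open>z = i \<alpha>\<close> twice, which forces
  \<alpha> = 0 and \<open>z = 0\<close>.\<close>

lemma root_eq_0:
  assumes "lam \<noteq> 0" "g \<noteq> 0" "\<And>f. f \<in> W \<longleftrightarrow> g dvd f" "poly g z = 0"
  shows "z = 0 \<and> \<alpha> = 0"
proof -
  have *: "z = of_int i * \<alpha>" if "poly g (z - of_int i) \<noteq> 0" for i
    using poly_root_of_dvd[OF generator_dvd_shift[OF assms(1,3)] assms(4), of i] that by (simp add: poly_shift)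
  obtain i where i: "poly g (z - of_int i) \<noteq> 0"
    using ex_int_not_root[OF assms(2), of "{}" z] by auto
  moreover obtain j where j: "j \<noteq> i" "poly g (z - of_int j) \<noteq> 0"
    using ex_int_not_root[OF assms(2), of "{i}" z] by auto
  ultimately have "of_int i * \<alpha> = of_int j * \<alpha>" using * by metis
  with j have "\<alpha> = 0" by simp
  with *[OF i] show ?thesis by simp
qed

lemma no_proper:
  assumes "0 \<le> Re a" "Re a < 1" "lam \<noteq> 0" "\<alpha> \<noteq> 0 \<or> (gamma_exists a b \<and> \<gamma> \<noteq> 0)" "W \<noteq> {0}"
  shows "W = UNIV"
proof -
  obtain g where g: "g \<noteq> 0" "\<And>f. f \<in> W \<longleftrightarrow> g dvd f" using principal assms(5) by blast
  have "poly g z \<noteq> 0" for z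
  proof
    assume z: "poly g z = 0"
    with root_eq_0[OF assms(3) g] assms(4) have \<gamma>: "gamma_exists a b" "\<gamma> \<noteq> 0" by auto
    have "poly g (z - a - of_int i) = 0" for i
    proof -
      \<comment> \<open>By this scalar \<open>H_idx i 0\<close> differs from the plain shift by
        \<open>a + i\<close>.\<close>
      define c where "c = (if b = 0 then lam powi i * \<gamma> else a * lam powi i * \<gamma> / (a + of_int i))"
      have "c \<noteq> 0" "omega_H a b lam \<beta> \<gamma> i 0 g = Polynomial.smult c (shift (a + of_int i) g)"
        using \<gamma> assms(3) add_of_int_neq_0[OF assms(1,2), of i]
        by (auto simp: c_def gamma_exists_def omega_H_def deriv_shift_def shift_def)
      then have "g dvd shift (a + of_int i) g"
        using basis_act[of g "H_idx i 0"] g by (simp add: dvd_smult_iff)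
      from poly_root_of_dvd[OF this z] show ?thesis by (simp add: poly_shift algebra_simps)
    qed
    \<comment> \<open>A nonzero polynomial cannot vanish on the whole coset \<open>z - a - i\<close>
      of the integers.\<close>
    then show False using ex_int_not_root[OF g(1), of "{}" "z - a"] by blast
  qed
  then have "g dvd 1" by (rule unit_if_no_root)
  then show ?thesis using g(2) dvd_trans one_dvd by blast
qed

lemma only_t_multiples:
  assumes "lam \<noteq> 0" "W \<noteq> {0}" "W \<noteq> UNIV" "\<alpha> = 0"
  shows "W = t_multiples"
proof -
  obtain g where g: "g \<noteq> 0" "\<And>f. f \<in> W \<longleftrightarrow> g dvd f" using principal assms(2) by blast
  have "\<not> g dvd 1" using g(2) dvd_trans one_dvd assms(3) by blast
  then obtain z where "poly g z = 0" using unit_if_no_root by blast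
  moreover from this have "z = 0" using root_eq_0[OF assms(1) g] by blast
  ultimately have root: "poly g 0 = 0" by simp
  then obtain h where h: "g = [:0, 1:] * h"
    using poly_eq_0_iff_dvd[of g 0] by (auto elim: dvdE)
  \<comment> \<open>The root 0 of \<open>g\<close> is simple: a root of \<open>h\<close> is again 0,
    and cancelling \<open>t\<close> in the divisibility gives
    \<open>h dvd shift (of_int i) g\<close>, hence \<open>g(-i) = 0\<close>, against the choice of
    \<open>i\<close>.\<close>
  have "poly h z \<noteq> 0" for z
  proof
    assume z: "poly h z = 0"
    then have "poly g z = 0" by (simp add: h)
    then have "z = 0" using root_eq_0[OF assms(1) g] by blast
    obtain i where i: "i \<noteq> 0" "poly g (0 - of_int i) \<noteq> 0"
      using ex_int_not_root[OF g(1), of "{0}" 0] by auto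
    have "[:0, 1:] * h dvd [:0, 1:] * shift (of_int i) g"
      using generator_dvd_shift[OF assms(1) g(2), of i] assms(4) h by simp
    then have "h dvd shift (of_int i) g" by (subst (asm) dvd_mult_cancel_left) simp
    from poly_root_of_dvd[OF this z] i \<open>z = 0\<close> show False by (simp add: poly_shift)
  qed
  then have "h dvd 1" by (rule unit_if_no_root)
  then have "g dvd [:0, 1:]" unfolding h using mult_dvd_mono[OF dvd_refl, of h 1 "[:0, 1:]"] by simp
  then have "f \<in> W" if "poly f 0 = 0" for f
    using that poly_eq_0_iff_dvd[of f 0] g(2) dvd_trans by auto
  moreover have "poly f 0 = 0" if "f \<in> W" for f
    using that g(2) root poly_root_of_dvd by blast
  ultimately show ?thesis by (auto simp: t_multiples_iff)
qed

end

section \<open>Determination of the submodules, and simplicity\<close>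

lemma lie_submodule_Omega:
  assumes "0 \<le> Re a" "Re a < 1" "lam \<noteq> 0"
    and W: "0 \<in> W" "\<And>f g. f \<in> W \<Longrightarrow> g \<in> W \<Longrightarrow> f + g \<in> W" "\<And>c f. f \<in> W \<Longrightarrow> Polynomial.smult c f \<in> W"
      "\<And>x f. f \<in> W \<Longrightarrow> omega_act a b lam \<alpha> \<beta> \<gamma> x f \<in> W"
  shows "lie_submodule complex_ring (HV a b) (Omega a b lam \<alpha> \<beta> \<gamma>) W"
proof -
  have V: "lie_module complex_ring (HV a b) (Omega a b lam \<alpha> \<beta> \<gamma>)" by (rule lie_module_Omega) fact+
  then have M: "Module.module complex_ring (Omega a b lam \<alpha> \<beta> \<gamma>)" by (simp add: lie_module_def)
  interpret M: Module.module complex_ring "Omega a b lam \<alpha> \<beta> \<gamma>" by (rule M)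
  \<comment> \<open>Closure under inverses thus follows from closure under scaling.\<close>
  have neg: "\<ominus>\<^bsub>Omega a b lam \<alpha> \<beta> \<gamma>\<^esub> f = Polynomial.smult (- 1) f" for f
    by (rule M.minus_equality) simp_all
  have "submodule W complex_ring (Omega a b lam \<alpha> \<beta> \<gamma>)"
    by (rule M.submoduleI) (use W in \<open>simp_all only: neg carrier_Omega zero_Omega add_Omega smult_Omega subset_UNIV\<close>)
  then show ?thesis using V W by (simp add: lie_submodule_def act_Omega)
qed

lemma submodules_Omega_0:
  assumes "0 \<le> Re a" "Re a < 1" "lam \<noteq> 0"
  shows "{W. lie_submodule complex_ring (HV a b) (Omega a b lam 0 \<beta> 0) W \<and> W \<noteq> {0} \<and> W \<noteq> UNIV} = {t_multiples}"
proof -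
  have "lie_submodule complex_ring (HV a b) (Omega a b lam 0 \<beta> 0) t_multiples"
    by (rule lie_submodule_Omega) (simp_all add: assms omega_act_in_t_multiples, simp_all add: t_multiples_iff)
  moreover have "[:0, 1:] \<in> t_multiples" "(1 :: complex poly) \<notin> t_multiples"
    by (simp_all add: t_multiples_iff)
  then have "t_multiples \<noteq> {0}" "t_multiples \<noteq> UNIV" by (metis singletonD pCons_eq_0_iff zero_neq_one, metis UNIV_I)
  moreover have "W = t_multiples"
    if "lie_submodule complex_ring (HV a b) (Omega a b lam 0 \<beta> 0) W" "W \<noteq> {0}" "W \<noteq> UNIV" for W
  proof -
    interpret omega_submodule a b lam 0 \<beta> 0 W by unfold_locales fact
    show ?thesis by (rule only_t_multiples) (use assms that in auto)
  qed
  ultimately show ?thesis by blast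
qed

lemma simple_Omega_iff:
  assumes "0 \<le> Re a" "Re a < 1" "lam \<noteq> 0"
  shows "simple_lie_module complex_ring (HV a b) (Omega a b lam \<alpha> \<beta> \<gamma>)
    \<longleftrightarrow> \<alpha> \<noteq> 0 \<or> (gamma_exists a b \<and> \<gamma> \<noteq> 0)" (is "?simple \<longleftrightarrow> ?cond")
proof
  assume ?simple
  show ?cond
  proof (rule ccontr)
    assume "\<not> ?cond"
    \<comment> \<open>Without the condition the module is the one that has
      \<open>t_multiples\<close> as a proper submodule.\<close>
    then have "Omega a b lam \<alpha> \<beta> \<gamma> = Omega a b lam 0 \<beta> 0"
      using Omega_gamma_irrelevant[of a b \<gamma> 0] by simp
    then have "simple_lie_module complex_ring (HV a b) (Omega a b lam 0 \<beta> 0)"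
      using \<open>?simple\<close> by simp
    moreover have "t_multiples \<in> {W. lie_submodule complex_ring (HV a b) (Omega a b lam 0 \<beta> 0) W \<and> W \<noteq> {0} \<and> W \<noteq> UNIV}"
      unfolding submodules_Omega_0[OF assms] by simp
    ultimately show False unfolding simple_lie_module_def carrier_Omega zero_Omega by blast
  qed
next
  assume ?cond
  have "W = UNIV" if "lie_submodule complex_ring (HV a b) (Omega a b lam \<alpha> \<beta> \<gamma>) W" "W \<noteq> {0}" for W
  proof -
    interpret omega_submodule a b lam \<alpha> \<beta> \<gamma> W by unfold_locales fact
    show ?thesis by (rule no_proper) (use assms that \<open>?cond\<close> in auto)
  qed
  moreover have "(1 :: complex poly) \<noteq> 0" by simp
  then have "(UNIV :: complex poly set) \<noteq> {0}" by blast
  ultimately show ?simple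
    using lie_module_Omega[OF assms] by (auto simp: simple_lie_module_def)
qed

section \<open>Isomorphisms\<close>

text \<open>Moving the twisted shift past \<open>t\<close> produces \<open>t - i\<close> and an
  extra \<open>m\<close> times the lower power, exactly the terms of the operator with \<alpha> =
  1.\<close>

lemma omega_L_mult_t:
  "omega_L lam 0 \<beta> i m ([:0, 1:] * f) = [:0, 1:] * omega_L lam 1 \<beta> i m f"
  unfolding omega_L_eq twist_shift_mult_linear by (simp add: mult.left_commute)

lemma omega_act_mult_t:
  "omega_act a b lam 0 \<beta> 0 x ([:0, 1:] * f) = [:0, 1:] * omega_act a b lam 1 \<beta> 0 x f"
proof -
  have "omega_basis_act a b lam 0 \<beta> 0 p ([:0, 1:] * f) = [:0, 1:] * omega_basis_act a b lam 1 \<beta> 0 p f" for p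
    by (cases p) (simp_all only: omega_basis_act.simps omega_L_mult_t omega_H_trivial mult_zero_right simp_thms)
  then show ?thesis
    unfolding omega_act_def lin_ext_def sum_distrib_left by (simp only: mult_smult_right)
qed

lemma t_multiples_isomorphic:
  assumes "0 \<le> Re a" "Re a < 1" "lam \<noteq> 0"
  shows "lie_module_isomorphic complex_ring (HV a b)
    ((Omega a b lam 0 \<beta> 0)\<lparr>carrier := t_multiples\<rparr>) (Omega a b lam 1 \<beta> 0)"
proof -
  \<comment> \<open>Division by \<open>t\<close> is linear on all polynomials and on
    \<open>t_multiples\<close> inverts multiplication by \<open>t\<close>, which intertwines the
    actions by \<open>omega_act_mult_t\<close>.\<close>
  define \<phi> where "\<phi> f = f div [:0, 1:]" for f :: "complex poly"
  have \<phi>: "\<phi> ([:0, 1:] * f) = f" for f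
    unfolding \<phi>_def by (rule nonzero_mult_div_cancel_left) simp
  have inv: "f = [:0, 1:] * \<phi> f" if "f \<in> t_multiples" for f
    using that \<phi> by (auto simp: t_multiples_def)
  have "lie_module complex_ring (HV a b) ((Omega a b lam 0 \<beta> 0)\<lparr>carrier := t_multiples\<rparr>)"
    by (rule lie_module_Omega_restrict) (simp_all add: assms omega_act_in_t_multiples, simp_all add: t_multiples_iff)
  moreover have "bij_betw \<phi> t_multiples UNIV"
    by (rule bij_betw_byWitness[where f' = "\<lambda>f. [:0, 1:] * f"])
      (use \<phi> inv in \<open>auto simp: t_multiples_def\<close>)
  moreover have "\<phi> (f + g) = \<phi> f + \<phi> g" "\<phi> (Polynomial.smult c f) = Polynomial.smult c (\<phi> f)" for f g c
    by (simp_all add: \<phi>_def poly_div_add_left div_smult_left)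
  moreover have "\<phi> (omega_act a b lam 0 \<beta> 0 x f) = omega_act a b lam 1 \<beta> 0 x (\<phi> f)" if "f \<in> t_multiples" for x f
    using omega_act_mult_t \<phi> inv[OF that] by metis
  ultimately show ?thesis
    using lie_module_Omega[OF assms] act_Omega
    unfolding lie_module_isomorphic_def lie_module_iso_def
    by (intro exI[of _ \<phi>]) (simp add: Omega_def)
qed

lemma Omega_iso_imp_act_eq:
  assumes "lie_module_iso complex_ring (HV a b) (Omega a b lam1 \<alpha>1 \<beta>1 \<gamma>1) (Omega a b lam2 \<alpha>2 \<beta>2 \<gamma>2) \<phi>"
  shows "omega_basis_act a b lam1 \<alpha>1 \<beta>1 \<gamma>1 p f = omega_basis_act a b lam2 \<alpha>2 \<beta>2 \<gamma>2 p f"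
proof -
  have bij: "bij \<phi>" and add: "\<phi> (f + g) = \<phi> f + \<phi> g"
    and smult: "\<phi> (Polynomial.smult c f) = Polynomial.smult c (\<phi> f)"
    and "\<phi> (omega_act a b lam1 \<alpha>1 \<beta>1 \<gamma>1 x f) = omega_act a b lam2 \<alpha>2 \<beta>2 \<gamma>2 x (\<phi> f)" for f g c x
    using assms by (simp_all add: lie_module_iso_def act_Omega)
  from this(4)[of "Poly_Mapping.single _ 1"]
  have act: "\<phi> (omega_basis_act a b lam1 \<alpha>1 \<beta>1 \<gamma>1 p f) = omega_basis_act a b lam2 \<alpha>2 \<beta>2 \<gamma>2 p (\<phi> f)" for p f
    by (simp add: omega_act_single)
  have t: "\<phi> ([:0, 1:] * f) = [:0, 1:] * \<phi> f" for f
    using act[of "L_idx 0 0" f] by (simp only: omega_basis_act.simps omega_L_0_0)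
  have \<phi>: "\<phi> f = f * \<phi> 1" for f
  proof (induction f)
    case 0
    show ?case using smult[of 0 0] by simp
  next
    case (pCons c f)
    have "pCons c f = Polynomial.smult c 1 + [:0, 1:] * f" by simp
    then have "\<phi> (pCons c f) = Polynomial.smult c (\<phi> 1) + [:0, 1:] * (f * \<phi> 1)"
      by (simp only: add smult t pCons.IH)
    then show ?case by simp
  qed
  \<comment> \<open>Surjectivity makes \<open>\<phi> 1\<close> a unit, that is, a nonzero constant;
    this scalar then cancels from the intertwining relation.\<close>
  obtain f0 where "\<phi> f0 = 1" using bij by (metis bij_pointE)
  then have "\<phi> 1 dvd 1" using \<phi>[of f0] by (metis dvd_triv_right)
  then obtain k where k: "\<phi> 1 = [:k:]" "k \<noteq> 0" by (metis is_unit_poly_iff not_is_unit_0)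
  then have "\<phi> f = Polynomial.smult k f" for f using \<phi>[of f] by simp
  with act[of p f] show ?thesis
    by - (rule smult_cancel_left[OF k(2)], simp add: omega_basis_act_smult)
qed

lemma isomorphic_Omega_iff:
  assumes "0 \<le> Re a" "Re a < 1" "lam1 \<noteq> 0" "lam2 \<noteq> 0"
  shows "lie_module_isomorphic complex_ring (HV a b) (Omega a b lam1 \<alpha>1 \<beta>1 \<gamma>1) (Omega a b lam2 \<alpha>2 \<beta>2 \<gamma>2)
    \<longleftrightarrow> lam1 = lam2 \<and> \<alpha>1 = \<alpha>2 \<and> \<beta>1 = \<beta>2 \<and> (gamma_exists a b \<longrightarrow> \<gamma>1 = \<gamma>2)" (is "?iso \<longleftrightarrow> ?eq")
proof
  assume ?iso
  then have eq: "omega_basis_act a b lam1 \<alpha>1 \<beta>1 \<gamma>1 p f = omega_basis_act a b lam2 \<alpha>2 \<beta>2 \<gamma>2 p f" for p f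
    using Omega_iso_imp_act_eq by (metis lie_module_isomorphic_def)
  \<comment> \<open>The element 1 goes to \<open>\<beta> t + \<alpha>\<close> under
    \<open>L_idx 0 1\<close>, to \<open>\<lambda> (t - \<alpha>)\<close> under
    \<open>L_idx 1 0\<close>, and to \<gamma> under \<open>H_idx 0 0\<close>, where for
    \<open>b = 1\<close> the factor \<open>a\<close> cancels the denominator.\<close>
  have "\<alpha>1 = \<alpha>2" "\<beta>1 = \<beta>2"
    using eq[of "L_idx 0 1" 1] by (simp_all add: omega_L_def deriv_shift_def pcompose_1 pderiv_1)
  moreover have "lam1 = lam2"
    using eq[of "L_idx 1 0" 1] by (simp add: omega_L_def deriv_shift_def pcompose_1)
  moreover have "\<gamma>1 = \<gamma>2" if "gamma_exists a b"
    using eq[of "H_idx 0 0" 1] that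
    by (auto simp: omega_H_def deriv_shift_def pcompose_1 gamma_exists_def smult_eq_iff)
  ultimately show ?eq by blast
next
  assume ?eq
  then have "Omega a b lam1 \<alpha>1 \<beta>1 \<gamma>1 = Omega a b lam2 \<alpha>2 \<beta>2 \<gamma>2"
    using Omega_gamma_irrelevant[of a b \<gamma>1 \<gamma>2] by (cases "gamma_exists a b") auto
  moreover have "lie_module_iso complex_ring (HV a b) (Omega a b lam2 \<alpha>2 \<beta>2 \<gamma>2) (Omega a b lam2 \<alpha>2 \<beta>2 \<gamma>2) id"
    using lie_module_Omega[OF assms(1,2,4)] by (simp add: lie_module_iso_def)
  ultimately show ?iso by (auto simp: lie_module_isomorphic_def)
qed

section \<open>The trivial quotient\<close>

text \<open>A coset of \<open>t_multiples\<close> is determined by the common value of its members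
  at 0, so \<open>C\<close> identifies the quotient with the complex numbers.\<close>

lemma quotient_Omega:
  fixes a b lam \<beta> :: complex
  defines "Q \<equiv> lie_quotient (Omega a b lam 0 \<beta> 0) t_multiples"
    and "C \<equiv> \<lambda>c. {f :: complex poly. poly f 0 = c}"
  shows "carrier Q = range C" "\<zero>\<^bsub>Q\<^esub> = C 0" "C c \<oplus>\<^bsub>Q\<^esub> C d = C (c + d)"
    "k \<odot>\<^bsub>Q\<^esub> C c = C (k * c)" "act Q x (C c) = C 0"
proof -
  let ?V = "Omega a b lam 0 \<beta> 0"
  have T: "t_multiples = C 0" by (auto simp: t_multiples_iff C_def)
  have C: "[:c:] \<in> C c" for c by (simp add: C_def)
  have coset: "t_multiples +>\<^bsub>?V\<^esub> f = C (poly f 0)" for f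
  proof -
    have "\<exists>h. poly h 0 = 0 \<and> g = h + f" if "poly g 0 = poly f 0" for g
      using that by (intro exI[of _ "g - f"]) simp
    then show ?thesis by (auto simp: a_r_coset_def' T C_def)
  qed
  show "carrier Q = range C"
  proof -
    have "carrier Q = (\<Union>f. {C (poly f 0)})"
      by (simp add: Q_def lie_quotient_def A_RCOSETS_def' coset)
    also have "C c \<in> (\<Union>f. {C (poly f 0)})" for c
      by (rule UN_I[of "[:c:]"]) simp_all
    then have "(\<Union>f. {C (poly f 0)}) = range C" by blast
    finally show ?thesis .
  qed
  show "\<zero>\<^bsub>Q\<^esub> = C 0"
    by (simp add: Q_def lie_quotient_def T)
  show "C c \<oplus>\<^bsub>Q\<^esub> C d = C (c + d)"
  proof -
    have "\<exists>h k. poly h 0 = c \<and> poly k 0 = d \<and> g = h + k" if "poly g 0 = c + d" for g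
      using that by (intro exI[of _ "[:c:]"] exI[of _ "g - [:c:]"]) simp
    then show ?thesis by (auto simp: Q_def lie_quotient_def set_add_def' C_def)
  qed
  \<comment> \<open>All sets in the union coincide; since \<open>[:c:]\<close> lies in
    \<open>C c\<close>, the union is not empty and equals each of them.\<close>
  show "k \<odot>\<^bsub>Q\<^esub> C c = C (k * c)"
    using C[of c] by (auto simp: Q_def lie_quotient_def coset) (auto simp: C_def)
  have "poly (act ?V x f) 0 = 0" for f
    using omega_act_in_t_multiples by (simp add: act_Omega t_multiples_iff)
  then show "act Q x (C c) = C 0"
    using C[of c] by (auto simp: Q_def lie_quotient_def coset)
qed

lemma lie_module_quotient_Omega:
  "lie_module complex_ring (HV a b) (lie_quotient (Omega a b lam 0 \<beta> 0) t_multiples)" (is "lie_module _ _ ?Q")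
proof -
  note Q = quotient_Omega[of a b lam \<beta>]
  let ?C = "\<lambda>c. {f :: complex poly. poly f 0 = c}"
  have group: "abelian_group ?Q"
  proof (rule abelian_groupI, goal_cases)
    case (6 x)
    then obtain c where "x = ?C c" by (auto simp: Q)
    then show ?case by (intro bexI[of _ "?C (- c)"]) (simp_all add: Q)
  qed (auto simp: Q add_ac)
  then interpret abelian_group ?Q .
  have "Module.module complex_ring ?Q"
    by (intro moduleI cring_complex_ring group) (auto simp: Q ring_of_type_algebra_def algebra_simps)
  \<comment> \<open>Everything acts by zero, so \<open>act_bracket\<close> reduces to this
    equation.\<close>
  moreover have "?C 0 \<ominus>\<^bsub>?Q\<^esub> ?C 0 = ?C 0"
    using r_neg[of "?C 0"] by (simp add: Q a_minus_def)
  then have "lie_module_axioms complex_ring (HV a b) ?Q"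
    by (intro lie_module_axioms.intro) (auto simp: Q)
  ultimately show ?thesis
    by (intro lie_module.intro lie_algebra_HV)
qed

theorem theorem3p6:
  fixes a b :: complex
  assumes "0 \<le> Re a" and "Re a < 1"
  shows
    "(\<forall>lam \<alpha> \<beta> \<gamma>. lam \<noteq> 0 \<longrightarrow>
        (simple_lie_module complex_ring (HV a b) (Omega a b lam \<alpha> \<beta> \<gamma>)
          \<longleftrightarrow> \<alpha> \<noteq> 0 \<or> (gamma_exists a b \<and> \<gamma> \<noteq> 0)))
     \<and>
     (\<forall>lam \<beta>. lam \<noteq> 0 \<longrightarrow>
        {W. lie_submodule complex_ring (HV a b) (Omega a b lam 0 \<beta> 0) W
            \<and> W \<noteq> {0} \<and> W \<noteq> UNIV} = {t_multiples}
        \<and> lie_module_isomorphic complex_ring (HV a b)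
            ((Omega a b lam 0 \<beta> 0)\<lparr>carrier := t_multiples\<rparr>) (Omega a b lam 1 \<beta> 0)
        \<and> one_dimensional complex_ring (lie_quotient (Omega a b lam 0 \<beta> 0) t_multiples)
        \<and> trivial_lie_module complex_ring (HV a b)
            (lie_quotient (Omega a b lam 0 \<beta> 0) t_multiples))
     \<and>
     (\<forall>lam1 \<alpha>1 \<beta>1 \<gamma>1 lam2 \<alpha>2 \<beta>2 \<gamma>2. lam1 \<noteq> 0 \<and> lam2 \<noteq> 0 \<longrightarrow>
        (lie_module_isomorphic complex_ring (HV a b)
            (Omega a b lam1 \<alpha>1 \<beta>1 \<gamma>1) (Omega a b lam2 \<alpha>2 \<beta>2 \<gamma>2)
          \<longleftrightarrow> lam1 = lam2 \<and> \<alpha>1 = \<alpha>2 \<and> \<beta>1 = \<beta>2 \<and> (gamma_exists a b \<longrightarrow> \<gamma>1 = \<gamma>2)))"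
proof (intro conjI allI impI)
  fix lam \<beta> :: complex
  let ?Q = "lie_quotient (Omega a b lam 0 \<beta> 0) t_multiples"
  let ?C = "\<lambda>c. {f :: complex poly. poly f 0 = c}"
  note Q = quotient_Omega[of a b lam \<beta>]
  \<comment> \<open>The coset \<open>?C 1\<close> spans the quotient, since \<open>?C c\<close> is
    \<open>c\<close> times it; the polynomial 1 separates it from the zero coset.\<close>
  have "1 \<in> ?C 1" "1 \<notin> ?C 0" by simp_all
  then have "?C 1 \<noteq> ?C 0" by blast
  then show "one_dimensional complex_ring ?Q"
    unfolding one_dimensional_def by (intro bexI[of _ "?C 1"]) (auto simp: Q)
  show "trivial_lie_module complex_ring (HV a b) ?Q"
    using lie_module_quotient_Omega by (auto simp: trivial_lie_module_def Q)
qed (rule simple_Omega_iff[OF assms] submodules_Omega_0[OF assms] t_multiples_isomorphic[OF assms] isomorphic_Omega_iff[OF assms]; simp)+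

end
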